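(* Let $d\ge 1$. There exist constants $C_1>0$, $C_2>0$, $\alpha_1>0$, $\alpha_2>0$ depending only on $d$, a sequence $N_j\to\infty$, and a sequence of real-valued Schwartz functions $f_j:\mathbb R^d\to\mathbb R$ with \[ \mathrm{supp}(\widehat{f_j})\subset\{\xi\in\mathbb R^d:\ \alpha_1 N_j<|\xi|<\alpha_2 N_j\} \] such that for all $j$, \[ -C_2<\frac{\int_{\mathbb R^d}(\Delta^2 f_j)\, f_j^3\,dx}{N_j^4\int_{\mathbb R^d} f_j^4\,dx}<-C_1<0 . \]
   Context: The Fourier transform on $\mathbb R^d$ is $\widehat f(\xi)=\int_{\mathbb R^d} f(x)e^{-i\xi\cdot x}dx$. $\Delta^2$ denotes the biharmonic operator (square of the Laplacian). *)

theory Defs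
  imports "HOL-Analysis.Analysis"
begin

text \<open>Iterated partial derivatives: the list bs of basis vectors encodes a multi-index;
  pderivs [b1,...,bk] f = partial_{b1} ... partial_{bk} f.\<close>
fun pderivs :: "'a::euclidean_space list \<Rightarrow> ('a \<Rightarrow> real) \<Rightarrow> 'a \<Rightarrow> real" where
  "pderivs [] f = f"
| "pderivs (b # bs) f = (\<lambda>x. frechet_derivative (pderivs bs f) (at x) b)"

definition schwartz :: "('a::euclidean_space \<Rightarrow> real) \<Rightarrow> bool" where
  "schwartz f \<longleftrightarrow>
     (\<forall>bs. set bs \<subseteq> Basis \<longrightarrow>
        (\<forall>x. pderivs bs f differentiable (at x)) \<and>
        (\<forall>k::nat. bounded (range (\<lambda>x. norm x ^ k * pderivs bs f x))))"

definition laplacian :: "('a::euclidean_space \<Rightarrow> real) \<Rightarrow> 'a \<Rightarrow> real" where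
  "laplacian f = (\<lambda>x. \<Sum>b\<in>Basis. pderivs [b, b] f x)"

definition bilaplacian :: "('a::euclidean_space \<Rightarrow> real) \<Rightarrow> 'a \<Rightarrow> real" where
  "bilaplacian f = laplacian (laplacian f)"

definition fourier :: "('a::euclidean_space \<Rightarrow> real) \<Rightarrow> 'a \<Rightarrow> complex" where
  "fourier f \<xi> = integral UNIV (\<lambda>x. complex_of_real (f x) * cis (- (\<xi> \<bullet> x)))"

definition fsupport :: "('a::euclidean_space \<Rightarrow> complex) \<Rightarrow> 'a set" where
  "fsupport g = closure {\<xi>. g \<xi> \<noteq> 0}"

end

theory Submission
  imports Defs "HOL-Probability.Sinc_Integral"
begin

text \<open>For \<open>g t = cos t - cos (3 t) / 12\<close> the mean of \<open>g'''' g\<^sup>3\<close> over a period is negative. Let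
  \<open>\<phi>\<close> be the inverse Fourier transform of the bump \<open>exp (- 1 / (1 - s\<^sup>2))\<close> on \<open>(-1, 1)\<close>; then
  \<open>G x = g (K x) \<phi> x\<close> has Fourier support in \<open>K - 1 \<le> |\<eta>| \<le> 3 K + 1\<close>, and for large \<open>K\<close> the sign of
  \<open>\<integral> G'''' G\<^sup>3\<close> is that of the mean. In dimension \<open>d\<close> take \<open>G\<close> in one coordinate and the wide envelopes
  \<open>\<phi> (\<epsilon> x)\<close> in the others: all integrals factor, and the terms with derivatives of the envelopes are
  \<open>O(\<epsilon>\<^sup>2)\<close>. Rescaling by \<open>N\<close> does not change the normalised ratio.

  No Fourier inversion is needed: for \<open>|\<theta>| > 1\<close> the function \<open>\<phi> x exp (- i \<theta> x)\<close> is the derivative of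
  \<open>- i exp (- i \<theta> x)\<close> times the inverse transform of the bump divided by \<open>s - \<theta>\<close>, which vanishes at infinity.\<close>

subsection \<open>One-dimensional Schwartz functions\<close>

text \<open>\<open>F n\<close> is the \<open>n\<close>-th derivative of \<open>F 0\<close>. Carrying
  the whole sequence gives every derivative by an explicit formula, with no iterated derivative
  operator to evaluate.\<close>

definition schwartz_seq :: "(nat \<Rightarrow> real \<Rightarrow> real) \<Rightarrow> bool" where
  "schwartz_seq F \<longleftrightarrow>
     (\<forall>n x. (F n has_real_derivative F (Suc n) x) (at x)) \<and>
     (\<forall>n k. bounded (range (\<lambda>x. x ^ k * F n x)))"

lemma schwartz_seq_deriv:
  "schwartz_seq F \<Longrightarrow> (F n has_real_derivative F (Suc n) x) (at x)"
  by (auto simp: schwartz_seq_def)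

lemma schwartz_seq_continuous: "schwartz_seq F \<Longrightarrow> continuous_on A (F n)"
  by (meson schwartz_seq_deriv DERIV_isCont continuous_at_imp_continuous_on)

lemma schwartz_seq_measurable: "schwartz_seq F \<Longrightarrow> F n \<in> borel_measurable borel"
  by (intro borel_measurable_continuous_onI schwartz_seq_continuous)

lemma schwartz_seq_bounded:
  assumes "schwartz_seq F"
  obtains C where "C \<ge> 0" "\<And>x. \<bar>F n x\<bar> \<le> C"
proof -
  have "bounded (range (\<lambda>x. x ^ 0 * F n x))"
    using assms unfolding schwartz_seq_def by blast
  then obtain C where C: "\<And>x. norm (F n x) \<le> C" by (auto simp: bounded_iff)
  have "C \<ge> 0" using C[of 0] norm_ge_zero order_trans by blast
  then show thesis using that[of C] C by auto
qed

text \<open>Either \<open>1 + \<bar>x\<bar> \<le> 2\<close> or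
  \<open>1 + \<bar>x\<bar> \<le> 2 * \<bar>x\<bar>\<close>. Unlike \<open>\<bar>x\<bar>\<close>,
  this weight never drops below 1, so products of it over the coordinates control the Euclidean
  norm.\<close>

lemma schwartz_seq_bounded_poly:
  assumes "schwartz_seq F"
  obtains C where "C \<ge> 0" "\<And>x. (1 + \<bar>x\<bar>) ^ k * \<bar>F n x\<bar> \<le> C"
proof -
  obtain C where C: "C \<ge> 0" "\<And>x. \<bar>F n x\<bar> \<le> C" using schwartz_seq_bounded[OF assms] by blast
  have "bounded (range (\<lambda>x. x ^ k * F n x))"
    using assms unfolding schwartz_seq_def by blast
  then obtain D where D: "\<And>x. norm (x ^ k * F n x) \<le> D" by (auto simp: bounded_iff)
  have "D \<ge> 0" using D[of 0] norm_ge_zero order_trans by blast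
  have "(1 + \<bar>x\<bar>) ^ k * \<bar>F n x\<bar> \<le> 2 ^ k * (C + D)" for x
  proof (cases "\<bar>x\<bar> \<le> 1")
    case True
    have "(1 + \<bar>x\<bar>) ^ k * \<bar>F n x\<bar> \<le> 2 ^ k * C"
      using True C by (intro mult_mono power_mono) auto
    also have "\<dots> \<le> 2 ^ k * (C + D)" using \<open>D \<ge> 0\<close> by simp
    finally show ?thesis .
  next
    case False
    have "(1 + \<bar>x\<bar>) ^ k * \<bar>F n x\<bar> \<le> (2 * \<bar>x\<bar>) ^ k * \<bar>F n x\<bar>"
      using False by (intro mult_right_mono power_mono) auto
    also have "\<dots> = 2 ^ k * norm (x ^ k * F n x)"
      by (simp add: power_mult_distrib abs_mult power_abs)
    also have "\<dots> \<le> 2 ^ k * (C + D)" using D[of x] C(1) by (intro mult_left_mono) auto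
    finally show ?thesis .
  qed
  moreover have "2 ^ k * (C + D) \<ge> 0" using C(1) \<open>D \<ge> 0\<close> by simp
  ultimately show thesis using that by blast
qed

lemma integrable_inverse_one_plus_square: "integrable lborel (\<lambda>x::real. inverse (1 + x\<^sup>2))"
  using integrable_inverse_1_plus_square by (simp add: set_integrable_def)

text \<open>The weight of order 2 makes \<open>F n\<close> at most a multiple of
  \<open>inverse (1 + x\<^sup>2)\<close>. The value field of \<open>g\<close> is general so that
  both real products and the complex factors \<open>cis\<close> are covered.\<close>

lemma schwartz_seq_integrable_mult:
  fixes g :: "real \<Rightarrow> 'b::{real_normed_field,banach,second_countable_topology}"
  assumes F: "schwartz_seq F" and g: "g \<in> borel_measurable borel" and B: "\<And>x. norm (g x) \<le> B"
  shows "integrable lborel (\<lambda>x. of_real (F n x) * g x)"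
proof -
  obtain C where C: "C \<ge> 0" "\<And>x. (1 + \<bar>x\<bar>) ^ 2 * \<bar>F n x\<bar> \<le> C"
    using schwartz_seq_bounded_poly[OF F, of 2 n] by auto
  have "B \<ge> 0" using B[of 0] norm_ge_zero order_trans by blast
  have bd: "\<bar>F n x\<bar> \<le> C * inverse (1 + x\<^sup>2)" for x
  proof -
    have "1 + x\<^sup>2 > 0" by (smt (verit) zero_le_power2)
    have "(1 + x\<^sup>2) * \<bar>F n x\<bar> \<le> (1 + \<bar>x\<bar>) ^ 2 * \<bar>F n x\<bar>"
      by (intro mult_right_mono) (auto simp: power2_sum)
    then have "(1 + x\<^sup>2) * \<bar>F n x\<bar> \<le> C" using C(2)[of x] by linarith
    then show ?thesis using \<open>1 + x\<^sup>2 > 0\<close> by (simp add: field_simps)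
  qed
  have [measurable]: "g \<in> borel_measurable borel" "F n \<in> borel_measurable borel"
    using g schwartz_seq_measurable[OF F] by auto
  show ?thesis
  proof (rule Bochner_Integration.integrable_bound)
    show "integrable lborel (\<lambda>x. (B * C) * inverse (1 + x\<^sup>2))"
      using integrable_inverse_one_plus_square by simp
    show "AE x in lborel. norm (of_real (F n x) * g x) \<le> norm (B * C * inverse (1 + x\<^sup>2))"
    proof (intro always_eventually allI)
      fix x
      have "norm (of_real (F n x) * g x) \<le> (C * inverse (1 + x\<^sup>2)) * B"
        unfolding norm_mult using bd[of x] B[of x] by (intro mult_mono) auto
      also have "\<dots> \<le> norm (B * C * inverse (1 + x\<^sup>2))" by (simp add: mult_ac)
      finally show "norm (of_real (F n x) * g x) \<le> norm (B * C * inverse (1 + x\<^sup>2))" .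
    qed
  qed measurable
qed

lemma schwartz_seq_integrable_power:
  assumes F: "schwartz_seq F"
  shows "integrable lborel (\<lambda>x. F n x * F m x ^ k)"
proof -
  obtain C where C: "\<And>x. \<bar>F m x\<bar> \<le> C" using schwartz_seq_bounded[OF F] by blast
  have "norm (F m x ^ k) \<le> C ^ k" for x using C[of x] by (simp add: power_abs power_mono)
  moreover have "(\<lambda>x. F m x ^ k) \<in> borel_measurable borel"
    using schwartz_seq_measurable[OF F, of m] by measurable
  ultimately show ?thesis using schwartz_seq_integrable_mult[OF F, of "\<lambda>x. F m x ^ k" "C ^ k"] by simp
qed

lemma schwartz_seq_tendsto_0:
  assumes "schwartz_seq F"
  shows "(F n \<longlongrightarrow> 0) at_top" "(F n \<longlongrightarrow> 0) at_bot"
proof -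
  obtain C where C: "C \<ge> 0" "\<And>x. (1 + \<bar>x\<bar>) ^ 1 * \<bar>F n x\<bar> \<le> C"
    using schwartz_seq_bounded_poly[OF assms, of 1 n] by auto
  have bd: "\<bar>F n x\<bar> \<le> C / (1 + \<bar>x\<bar>)" for x
    using C(2)[of x] by (simp add: field_simps)
  have "((\<lambda>x. C / (1 + \<bar>x\<bar>)) \<longlongrightarrow> 0) at_top" "((\<lambda>x::real. C / (1 + \<bar>x\<bar>)) \<longlongrightarrow> 0) at_bot"
    by real_asymp+
  then show "(F n \<longlongrightarrow> 0) at_top" "(F n \<longlongrightarrow> 0) at_bot"
    using bd by (auto intro!: Lim_null_comparison[where g="\<lambda>x. C / (1 + \<bar>x\<bar>)"] always_eventually)
qed

lemma schwartz_seq_scale: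
  assumes F: "schwartz_seq F" and c: "c \<noteq> 0"
  shows "schwartz_seq (\<lambda>n x. c ^ n * F n (c * x))"
  unfolding schwartz_seq_def
proof (intro conjI allI)
  fix n x
  show "((\<lambda>x. c ^ n * F n (c * x)) has_real_derivative c ^ Suc n * F (Suc n) (c * x)) (at x)"
    by (rule derivative_eq_intros DERIV_chain2[OF schwartz_seq_deriv[OF F]] refl | simp)+
next
  fix n k
  have "bounded (range (\<lambda>x. x ^ k * F n x))" using F by (auto simp: schwartz_seq_def)
  then obtain D where D: "\<And>x. norm (x ^ k * F n x) \<le> D" by (auto simp: bounded_iff)
  have "norm (x ^ k * (c ^ n * F n (c * x))) \<le> \<bar>c\<bar> ^ n / \<bar>c\<bar> ^ k * D" for x
  proof -
    have "norm (x ^ k * (c ^ n * F n (c * x))) = \<bar>c\<bar> ^ n / \<bar>c\<bar> ^ k * norm ((c * x) ^ k * F n (c * x))"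
      using c by (simp add: abs_mult power_abs power_mult_distrib)
    then show ?thesis using D[of "c * x"] by (simp only:) (intro mult_left_mono; simp)
  qed
  then show "bounded (range (\<lambda>x. x ^ k * (c ^ n * F n (c * x))))" unfolding bounded_iff by blast
qed

lemma schwartz_seq_lincomb:
  assumes F: "schwartz_seq F" and G: "schwartz_seq G"
  shows "schwartz_seq (\<lambda>n x. F n x + a * G n x)"
  unfolding schwartz_seq_def
proof (intro conjI allI)
  fix n x
  show "((\<lambda>x. F n x + a * G n x) has_real_derivative F (Suc n) x + a * G (Suc n) x) (at x)"
    by (rule derivative_eq_intros schwartz_seq_deriv[OF F] schwartz_seq_deriv[OF G] refl | simp)+
next
  fix n k
  have "bounded (range (\<lambda>x. x ^ k * F n x))" "bounded (range (\<lambda>x. x ^ k * G n x))"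
    using F G by (auto simp: schwartz_seq_def)
  then obtain C D where CD: "\<And>x. norm (x ^ k * F n x) \<le> C" "\<And>x. norm (x ^ k * G n x) \<le> D"
    by (auto simp: bounded_iff)
  have "norm (x ^ k * (F n x + a * G n x)) \<le> C + \<bar>a\<bar> * D" for x
  proof -
    have "norm (x ^ k * (F n x + a * G n x)) \<le> norm (x ^ k * F n x) + \<bar>a\<bar> * norm (x ^ k * G n x)"
      using norm_triangle_ineq[of "x ^ k * F n x" "a * (x ^ k * G n x)"]
      by (simp add: algebra_simps abs_mult)
    also have "\<dots> \<le> C + \<bar>a\<bar> * D" using CD by (intro add_mono mult_left_mono) auto
    finally show ?thesis .
  qed
  then show "bounded (range (\<lambda>x. x ^ k * (F n x + a * G n x)))" unfolding bounded_iff by blast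
qed

text \<open>The fundamental theorem on the whole line. Vector values allow it to serve complex
  Fourier integrals as well as real integration by parts.\<close>

lemma integral_deriv_eq_0:
  fixes K :: "real \<Rightarrow> 'a::euclidean_space"
  assumes "\<And>x. (K has_vector_derivative k x) (at x)" "continuous_on UNIV k"
    and "integrable lborel k" and "(K \<longlongrightarrow> 0) at_top" "(K \<longlongrightarrow> 0) at_bot"
  shows "(\<integral>x. k x \<partial>lborel) = 0"
proof -
  have "(LBINT x=-\<infinity>..\<infinity>. k x) = 0 - 0"
  proof (rule interval_integral_FTC_integrable[where F=K])
    show "((K \<circ> real_of_ereal) \<longlongrightarrow> 0) (at_right (-\<infinity>))" "((K \<circ> real_of_ereal) \<longlongrightarrow> 0) (at_left \<infinity>)"
      using assms by (simp_all add: ereal_tendsto_simps1)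
  qed (use assms in \<open>auto simp: set_integrable_def continuous_on_eq_continuous_at\<close>)
  then show ?thesis by (simp add: interval_lebesgue_integral_def set_lebesgue_integral_def)
qed

text \<open>If the integral vanished, the open set where \<open>F 0\<close> is nonzero would be a
  null set, hence empty. The integrand is kept as a product because it is then the case
  \<open>m = 0\<close> of \<open>F m x * F 0 x ^ 3\<close>.\<close>

lemma schwartz_seq_fourth_moment_pos:
  assumes F: "schwartz_seq F" and nz: "F 0 x0 \<noteq> 0"
  shows "(\<integral>x. F 0 x * F 0 x ^ 3 \<partial>lborel) > 0"
proof -
  have int: "integrable lborel (\<lambda>x. F 0 x * F 0 x ^ 3)"
    by (rule schwartz_seq_integrable_power[OF F])
  have eq: "F 0 x * F 0 x ^ 3 = F 0 x ^ 4" for x by (simp add: power_def eval_nat_numeral)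
  have nonneg: "0 \<le> F 0 x * F 0 x ^ 3" for x unfolding eq by simp
  have "(\<integral>x. F 0 x * F 0 x ^ 3 \<partial>lborel) \<noteq> 0"
  proof
    assume 0: "(\<integral>x. F 0 x * F 0 x ^ 3 \<partial>lborel) = 0"
    have cont: "continuous_on UNIV (F 0)" by (rule schwartz_seq_continuous[OF F])
    have ae: "AE x in lborel. F 0 x * F 0 x ^ 3 = 0"
      using integral_nonneg_eq_0_iff_AE[OF int] nonneg 0 by simp
    have "open {x. F 0 x \<noteq> 0}"
      using open_Collect_neq[OF cont continuous_on_const[of UNIV 0]] by simp
    moreover have "AE x in lborel. x \<notin> {x. F 0 x \<noteq> 0}" using ae by eventually_elim auto
    ultimately have "{x. F 0 x \<noteq> 0} \<in> null_sets lborel"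
      by (subst AE_iff_null_sets) auto
    then have "negligible {x. F 0 x \<noteq> 0}"
      using negligible_iff_null_sets null_sets_completionI by blast
    then have "{x. F 0 x \<noteq> 0} = {}"
      using open_not_negligible \<open>open {x. F 0 x \<noteq> 0}\<close> by blast
    then show False using nz by blast
  qed
  moreover have "(\<integral>x. F 0 x * F 0 x ^ 3 \<partial>lborel) \<ge> 0"
    by (rule integral_nonneg_AE) (use nonneg in auto)
  ultimately show ?thesis by linarith
qed

section \<open>Dilations in the quartic and Fourier integrals\<close>

lemma integral_scale_quartic:
  fixes F :: "nat \<Rightarrow> real \<Rightarrow> real"
  assumes "c > 0"
  shows "(\<integral>x. (c ^ m * F m (c * x)) * F 0 (c * x) ^ 3 \<partial>lborel) =
    c ^ m * (1 / c) * (\<integral>x. F m x * F 0 x ^ 3 \<partial>lborel)"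
  using lborel_integral_real_affine[of c "\<lambda>x. F m x * F 0 x ^ 3" 0] assms
  by (simp add: mult.assoc)

lemma integral_scale_cis:
  fixes F :: "real \<Rightarrow> real"
  assumes "c > 0"
  shows "(\<integral>x. of_real (F (c * x)) * cis (- (\<eta> * x)) \<partial>lborel) =
    of_real (1 / c) * (\<integral>x. of_real (F x) * cis (- ((\<eta> / c) * x)) \<partial>lborel)"
  using lborel_integral_real_affine[of c "\<lambda>x. of_real (F x) * cis (- ((\<eta> / c) * x))" 0] assms
  by (simp add: scaleR_conv_of_real)

subsection \<open>A smooth bump and its Fourier integral\<close>

definition bump :: "real poly \<Rightarrow> nat \<Rightarrow> real \<Rightarrow> real" where
  "bump p m s = (if \<bar>s\<bar> < 1 then poly p s * (inverse (1 - s\<^sup>2)) ^ m * exp (- inverse (1 - s\<^sup>2)) else 0)"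

text \<open>With \<open>v = inverse (1 - s\<^sup>2)\<close> one has
  \<open>v' = 2 * s * v\<^sup>2\<close>. The three terms of the product rule are brought to the
  common power \<open>v ^ (m + 2)\<close> by factors \<open>1 - s\<^sup>2\<close>, which is the
  polynomial \<open>[:1, 0, -1:]\<close>.\<close>

lemma bump_has_derivative_inside:
  assumes "\<bar>s\<bar> < 1"
  shows "(bump p m has_real_derivative
    bump (pderiv p * [:1, 0, -1:] ^ 2 + smult (of_nat m) ([:0, 2:] * [:1, 0, -1:] * p) - [:0, 2:] * p) (m + 2) s) (at s)"
proof -
  have pos: "1 - s\<^sup>2 > 0" using assms by (simp add: abs_square_less_1)
  define v where "v = inverse (1 - s\<^sup>2)"
  have wv: "(1 - s\<^sup>2) * v = 1" using pos by (simp add: v_def)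
  have dv: "((\<lambda>s. inverse (1 - s\<^sup>2)) has_real_derivative 2 * s * v\<^sup>2) (at s)"
    using pos by (auto intro!: derivative_eq_intros simp: v_def power2_eq_square)
  \<comment> \<open>For \<open>m = 0\<close> the truncated exponent \<open>m - 1\<close> does no
    harm, since the factor \<open>real m\<close> is zero.\<close>
  have pw: "real m * v ^ (m - 1) * v\<^sup>2 = real m * v ^ (m + 1)"
    by (cases m) (auto simp: power2_eq_square)
  have wv1: "(1 - s\<^sup>2) * v ^ (m + 2) = v ^ (m + 1)" "(1 - s\<^sup>2)\<^sup>2 * v ^ (m + 2) = v ^ m"
  proof -
    have "(1 - s\<^sup>2) * v ^ (m + 2) = ((1 - s\<^sup>2) * v) * v ^ (m + 1)" by (simp add: mult_ac)
    then show "(1 - s\<^sup>2) * v ^ (m + 2) = v ^ (m + 1)" by (simp only: wv mult_1)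
    have "(1 - s\<^sup>2)\<^sup>2 * v ^ (m + 2) = ((1 - s\<^sup>2) * v)\<^sup>2 * v ^ m"
      by (simp add: power2_eq_square mult_ac)
    then show "(1 - s\<^sup>2)\<^sup>2 * v ^ (m + 2) = v ^ m" by (simp only: wv one_power2 mult_1)
  qed
  define V :: "real \<Rightarrow> real" where "V = (\<lambda>s. inverse (1 - s\<^sup>2))"
  have V: "(V has_real_derivative 2 * s * v\<^sup>2) (at s)" "V s = v"
    using dv by (simp_all add: V_def v_def)
  have "((\<lambda>s. poly p s * V s ^ m * exp (- V s)) has_real_derivative
    (poly (pderiv p) s * v ^ m + 2 * s * poly p s * (real m * v ^ (m - 1) * v\<^sup>2)
      - 2 * s * poly p s * (v ^ m * v\<^sup>2)) * exp (- v)) (at s)"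
    by (rule derivative_eq_intros V(1) poly_DERIV refl)+ (simp add: V(2) algebra_simps)
  also have "(poly (pderiv p) s * v ^ m + 2 * s * poly p s * (real m * v ^ (m - 1) * v\<^sup>2)
      - 2 * s * poly p s * (v ^ m * v\<^sup>2)) * exp (- v) =
    (poly (pderiv p) s * ((1 - s\<^sup>2)\<^sup>2 * v ^ (m + 2)) + 2 * s * poly p s * (real m * ((1 - s\<^sup>2) * v ^ (m + 2)))
      - 2 * s * poly p s * v ^ (m + 2)) * exp (- v)"
    unfolding wv1 pw by (simp add: power_add power2_eq_square)
  also have "\<dots> =
    bump (pderiv p * [:1, 0, -1:] ^ 2 + smult (of_nat m) ([:0, 2:] * [:1, 0, -1:] * p) - [:0, 2:] * p) (m + 2) s"
    using assms by (simp add: bump_def flip: v_def) (simp add: algebra_simps power2_eq_square)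
  finally show ?thesis
  proof (rule DERIV_cong_ev[THEN iffD1, rotated -1, OF _ refl _ refl])
    have "\<forall>\<^sub>F x in nhds s. x \<in> {-1<..<1}"
      using assms by (intro eventually_nhds_in_open) auto
    then show "\<forall>\<^sub>F x in nhds s. poly p x * V x ^ m * exp (- V x) = bump p m x"
      by eventually_elim (auto simp: bump_def V_def)
  qed
qed

text \<open>The left side divided by \<open>fact k\<close> is one term of the exponential series,
  whose other terms and remainder are nonnegative.\<close>

lemma power_le_fact_exp:
  fixes v :: real
  assumes "v \<ge> 0"
  shows "v ^ k \<le> fact k * exp v"
proof -
  obtain t where t: "exp v = (\<Sum>m<Suc k. v ^ m / fact m) + exp t / fact (Suc k) * v ^ Suc k"
    using Maclaurin_exp_le by blast
  have "v ^ k / fact k \<le> (\<Sum>m<Suc k. v ^ m / fact m)"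
    using assms by (intro member_le_sum) auto
  also have "\<dots> \<le> exp v" unfolding t using assms by simp
  finally show ?thesis by (simp add: field_simps)
qed

text \<open>Using the exponential bound at the exponent \<open>m + 1\<close> leaves one spare factor
  \<open>1 - x\<^sup>2\<close>, which forces the function to 0 at both endpoints.\<close>

lemma bump_bound: "\<bar>bump p m x\<bar> \<le> \<bar>poly p x\<bar> * fact (m + 1) * \<bar>1 - x\<^sup>2\<bar>"
proof (cases "\<bar>x\<bar> < 1")
  case True
  then have pos: "1 - x\<^sup>2 > 0" by (simp add: abs_square_less_1)
  define v where "v = inverse (1 - x\<^sup>2)"
  have v: "v > 0" using pos by (simp add: v_def)
  have "v * (v ^ m * exp (- v)) \<le> fact (m + 1)"
    using power_le_fact_exp[of v "m + 1"] v by (simp add: exp_minus field_simps)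
  then have "v ^ m * exp (- v) \<le> fact (m + 1) * (1 - x\<^sup>2)"
    using pos by (simp add: v_def field_simps)
  then have "\<bar>poly p x\<bar> * (v ^ m * exp (- v)) \<le> \<bar>poly p x\<bar> * (fact (m + 1) * (1 - x\<^sup>2))"
    by (intro mult_left_mono) auto
  then show ?thesis using True pos v by (simp add: bump_def abs_mult mult.assoc flip: v_def)
qed (simp add: bump_def)

lemma bump_tendsto_endpoint:
  assumes "s = 1 \<or> s = -1"
  shows "(bump p m \<longlongrightarrow> 0) (at s)"
proof (rule Lim_null_comparison)
  show "\<forall>\<^sub>F x in at s. norm (bump p m x) \<le> \<bar>poly p x\<bar> * fact (m + 1) * \<bar>1 - x\<^sup>2\<bar>"
    using bump_bound by simp
  have "((\<lambda>x. \<bar>poly p x\<bar> * fact (m + 1) * \<bar>1 - x\<^sup>2\<bar>) \<longlongrightarrow> \<bar>poly p s\<bar> * fact (m + 1) * \<bar>1 - s\<^sup>2\<bar>) (at s)"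
    by (intro tendsto_intros)
  then show "((\<lambda>x. \<bar>poly p x\<bar> * fact (m + 1) * \<bar>1 - x\<^sup>2\<bar>) \<longlongrightarrow> 0) (at s)"
    using assms by auto
qed

text \<open>Only the endpoints need an argument. Continuity there, together with the derivative
  inside, is all that \<open>fint_by_parts\<close> asks for.\<close>

lemma continuous_on_bump: "continuous_on A (bump p m)"
proof -
  have "isCont (bump p m) s" for s
  proof -
    consider "\<bar>s\<bar> < 1" | "s = 1 \<or> s = -1" | "\<bar>s\<bar> > 1" by linarith
    then show ?thesis
    proof cases
      case 1
      then show ?thesis using bump_has_derivative_inside DERIV_isCont by blast
    next
      case 2
      then show ?thesis using bump_tendsto_endpoint[OF 2, of p m] by (auto simp: isCont_def bump_def)
    next
      case 3
      have "\<forall>\<^sub>F x in nhds s. x \<in> - {-1..1}"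
        using 3 by (intro eventually_nhds_in_open) auto
      then have "\<forall>\<^sub>F x in nhds s. bump p m x = (\<lambda>_. 0) x"
        by eventually_elim (auto simp: bump_def)
      then show ?thesis using isCont_cong[of "bump p m" "\<lambda>_. 0" s] by simp
    qed
  qed
  then show ?thesis by (simp add: continuous_at_imp_continuous_on)
qed

section \<open>Fourier integrals over a bounded interval\<close>

text \<open>This is \<open>2 * pi\<close> times the inverse Fourier transform of \<open>u\<close>
  cut off to the interval.\<close>

definition fint :: "(real \<Rightarrow> real) \<Rightarrow> real \<Rightarrow> complex" where
  "fint u x = integral {-1..1} (\<lambda>s. of_real (u s) * cis (x * s))"

lemma fint_integrable:
  "continuous_on {-1..1} u \<Longrightarrow> (\<lambda>s. of_real (u s) * cis (x * s)) integrable_on {-1..1}"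
  by (intro integrable_continuous_real continuous_intros)

lemma norm_fint_le:
  assumes "continuous_on {-1..1} u" "\<And>s. s \<in> {-1..1} \<Longrightarrow> \<bar>u s\<bar> \<le> B"
  shows "norm (fint u x) \<le> 2 * B"
proof -
  have "norm (integral {-1..1} (\<lambda>s. of_real (u s) * cis (x * s))) \<le> B * (1 - (-1))"
    by (rule integral_bound) (use assms in \<open>auto intro!: continuous_intros simp: norm_mult\<close>)
  then show ?thesis by (simp add: fint_def)
qed

lemma fint_add:
  assumes "continuous_on {-1..1} u" "continuous_on {-1..1} v"
  shows "fint (\<lambda>s. u s + v s) x = fint u x + fint v x"
  unfolding fint_def using assms
  by (subst Henstock_Kurzweil_Integration.integral_add[symmetric])
     (auto intro!: fint_integrable simp: distrib_right)

lemma fint_cmult: "fint (\<lambda>s. c * u s) x = of_real c * fint u x"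
  unfolding fint_def by (simp add: mult.assoc)

lemma fint_cong: "(\<And>s. s \<in> {-1..1} \<Longrightarrow> u s = v s) \<Longrightarrow> fint u x = fint v x"
  unfolding fint_def by (rule Henstock_Kurzweil_Integration.integral_cong) simp

text \<open>Differentiation under the integral sign: each derivative in \<open>x\<close> brings down
  a factor \<open>i * s\<close>.\<close>

lemma fint_has_derivative:
  assumes u: "continuous_on {-1..1} u"
  shows "(fint u has_vector_derivative \<i> * fint (\<lambda>s. s * u s) x) (at x)"
proof -
  have "((\<lambda>x. integral (cbox (-1) 1) (\<lambda>s. of_real (u s) * cis (x * s))) has_vector_derivative
      integral (cbox (-1) 1) (\<lambda>s. \<i> * (of_real (s * u s) * cis (x * s)))) (at x within UNIV)"
  proof (rule leibniz_rule_vector_derivative)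
    fix x s :: real assume "s \<in> cbox (-1) 1"
    show "((\<lambda>x. of_real (u s) * cis (x * s)) has_vector_derivative
        \<i> * (of_real (s * u s) * cis (x * s))) (at x within UNIV)"
      unfolding cis_conv_exp
      by (auto intro!: derivative_eq_intros has_vector_derivative_real_field simp: scaleR_conv_of_real algebra_simps)
  next
    show "(\<lambda>s. of_real (u s) * cis (x * s)) integrable_on cbox (-1) 1" for x
      using fint_integrable[OF u] by simp
    have "continuous_on (UNIV \<times> {-1..1}) (\<lambda>z::real\<times>real. u (snd z))"
      by (rule continuous_on_compose2[OF u continuous_on_snd[OF continuous_on_id]]) auto
    then show "continuous_on (UNIV \<times> cbox (- 1) 1) (\<lambda>(x, s). \<i> * (complex_of_real (s * u s) * cis (x * s)))"
      unfolding split_beta by (auto intro!: continuous_intros)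
  qed auto
  then show ?thesis unfolding fint_def[abs_def] by simp
qed

text \<open>The derivative of \<open>u s * cis (x * s)\<close> integrates to the boundary values,
  which vanish.\<close>

lemma fint_by_parts:
  assumes u: "continuous_on {-1..1} u" and v: "continuous_on {-1..1} v"
    and d: "\<And>s. \<bar>s\<bar> < 1 \<Longrightarrow> (u has_real_derivative v s) (at s)" and z: "u 1 = 0" "u (-1) = 0"
  shows "\<i> * of_real x * fint u x = - fint v x"
proof -
  have "((\<lambda>s. of_real (v s) * cis (x * s) + \<i> * of_real x * (of_real (u s) * cis (x * s))) has_integral
     of_real (u 1) * cis (x * 1) - of_real (u (-1)) * cis (x * (-1))) {-1..1}"
  proof (rule fundamental_theorem_of_calculus_interior)
    show "continuous_on {-1..1} (\<lambda>s. of_real (u s) * cis (x * s))"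
      using u by (intro continuous_intros)
    fix s :: real assume "s \<in> {-1<..<1}"
    then have s: "(u has_real_derivative v s) (at s)" using d by auto
    have 1: "((\<lambda>s. complex_of_real (u s)) has_vector_derivative of_real (v s)) (at s)"
      using s by (intro has_vector_derivative_of_real) (simp add: has_real_derivative_iff_has_vector_derivative)
    have 2: "((\<lambda>s. cis (x * s)) has_vector_derivative \<i> * of_real x * cis (x * s)) (at s)"
      unfolding cis_conv_exp
      by (auto intro!: derivative_eq_intros has_vector_derivative_real_field simp: algebra_simps)
    show "((\<lambda>s. of_real (u s) * cis (x * s)) has_vector_derivative
       of_real (v s) * cis (x * s) + \<i> * of_real x * (of_real (u s) * cis (x * s))) (at s)"
      using has_vector_derivative_mult[OF 1 2] by (simp add: algebra_simps)
  qed auto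
  then have "integral {-1..1} (\<lambda>s. of_real (v s) * cis (x * s) + \<i> * of_real x * (of_real (u s) * cis (x * s))) = 0"
    using z by (simp add: integral_unique)
  then have "fint v x + \<i> * of_real x * fint u x = 0"
    unfolding fint_def using fint_integrable[OF u] fint_integrable[OF v]
    by (subst (asm) Henstock_Kurzweil_Integration.integral_add) (auto intro!: integrable_on_mult_right)
  then show ?thesis by (simp add: add_eq_0_iff)
qed

text \<open>Each integration by parts trades one factor \<open>x\<close> for a derivative of the
  bump. That derivative is a bump with another polynomial and exponent, so the induction on
  \<open>k\<close> leaves \<open>p\<close> and \<open>m\<close> arbitrary.\<close>

lemma fint_bump_decay: "bounded (range (\<lambda>x. of_real x ^ k * fint (bump p m) x))"
proof (induction k arbitrary: p m)
  case 0
  have "compact (bump p m ` {-1..1})"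
    by (intro compact_continuous_image continuous_on_bump) simp
  then obtain B where "\<And>s. s \<in> {-1..1} \<Longrightarrow> \<bar>bump p m s\<bar> \<le> B"
    using compact_imp_bounded[of "bump p m ` {-1..1}"] by (fastforce simp: bounded_iff)
  then have "norm (fint (bump p m) x) \<le> 2 * B" for x
    by (intro norm_fint_le continuous_on_bump) auto
  then show ?case unfolding bounded_iff by auto
next
  case (Suc k)
  obtain q where q: "\<And>s. \<bar>s\<bar> < 1 \<Longrightarrow> (bump p m has_real_derivative bump q (m + 2) s) (at s)"
    using bump_has_derivative_inside by blast
  have "\<i> * of_real x * fint (bump p m) x = - fint (bump q (m + 2)) x" for x
    by (rule fint_by_parts) (use q continuous_on_bump in \<open>auto simp: bump_def\<close>)
  then have "norm (of_real x * fint (bump p m) x) = norm (fint (bump q (m + 2)) x)" for x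
    by (metis (no_types, lifting) norm_minus_cancel norm_mult norm_ii mult_1 mult.assoc)
  then have "norm (of_real x ^ Suc k * fint (bump p m) x) = norm (of_real x ^ k * fint (bump q (m + 2)) x)" for x
    by (simp add: norm_mult mult_ac)
  then show ?case using Suc.IH[of q "m + 2"] by (simp add: bounded_iff)
qed

subsection \<open>Band-limited wave packets\<close>

text \<open>The \<open>n\<close>-th derivative of \<open>cos (\<omega> x) \<phi> x\<close>, written so that differentiation multiplies the integrand
  by \<open>i (\<omega> + s)\<close>.\<close>

definition wave :: "real \<Rightarrow> nat \<Rightarrow> real \<Rightarrow> real" where
  "wave \<omega> n x = Re (\<i> ^ n * cis (\<omega> * x) * fint (bump ([:\<omega>, 1:] ^ n) 0) x)"

text \<open>Conjugation reverses the frequency, and the reflection of \<open>s\<close> reverses it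
  back. Hence the envelope is real.\<close>

lemma cnj_fint_even:
  assumes "\<And>s. u (- s) = u s"
  shows "cnj (fint u x) = fint u x"
proof -
  have "cnj (fint u x) = integral {-1..1} (\<lambda>s. of_real (u s) * cis (- (x * s)))"
    unfolding fint_def integral_cnj by (simp add: cis_cnj)
  also have "\<dots> = integral {- 1..1} (\<lambda>s. of_real (u (- s)) * cis (- (x * s)))"
    using assms by simp
  also have "\<dots> = fint u x"
    unfolding fint_def
    using Henstock_Kurzweil_Integration.integral_reflect_real[where f="\<lambda>s. of_real (u s) * cis (x * s)" and a="-1" and b=1] by simp
  finally show ?thesis .
qed

lemma wave_0_0: "of_real (wave 0 0 x) = fint (bump 1 0) x"
proof -
  have "cnj (fint (bump 1 0) x) = fint (bump 1 0) x"
    by (rule cnj_fint_even) (simp add: bump_def)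
  then show ?thesis by (simp add: wave_def complex_eq_iff)
qed

text \<open>The envelope is real by \<open>wave_0_0\<close>, so it leaves the real part and only the
  cosine remains inside.\<close>

lemma wave_0: "wave \<omega> 0 x = cos (\<omega> * x) * wave 0 0 x"
proof -
  have "wave \<omega> 0 x = Re (cis (\<omega> * x) * of_real (wave 0 0 x))"
    unfolding wave_0_0 by (simp add: wave_def)
  then show ?thesis by simp
qed

text \<open>In the product rule \<open>cis\<close> contributes \<open>i * \<omega>\<close> and
  \<open>fint\<close> contributes \<open>i * s\<close>; their sum is one more factor
  \<open>[:\<omega>, 1:]\<close> and one more \<open>\<i>\<close>. Decay is inherited from
  \<open>fint\<close>, since the remaining factors have modulus 1.\<close>

lemma schwartz_seq_wave: "schwartz_seq (wave \<omega>)"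
  unfolding schwartz_seq_def
proof (intro conjI allI)
  fix n x
  define u where "u = bump ([:\<omega>, 1:] ^ n) 0"
  have u: "continuous_on {-1..1} u" unfolding u_def by (rule continuous_on_bump)
  have "fint (bump ([:\<omega>, 1:] ^ Suc n) 0) x = fint (\<lambda>s. \<omega> * u s + s * u s) x"
    unfolding u_def by (rule fint_cong) (simp add: bump_def algebra_simps)
  also have "\<dots> = of_real \<omega> * fint u x + fint (\<lambda>s. s * u s) x"
    using u by (subst fint_add) (auto intro!: continuous_intros simp: fint_cmult)
  finally have eq: "fint (bump ([:\<omega>, 1:] ^ Suc n) 0) x = of_real \<omega> * fint u x + fint (\<lambda>s. s * u s) x" .
  have 1: "((\<lambda>x. \<i> ^ n * cis (\<omega> * x)) has_vector_derivative \<i> ^ n * (\<i> * of_real \<omega> * cis (\<omega> * x))) (at x)"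
    unfolding cis_conv_exp
    by (auto intro!: derivative_eq_intros has_vector_derivative_real_field simp: algebra_simps)
  have "((\<lambda>x. \<i> ^ n * cis (\<omega> * x) * fint u x) has_vector_derivative
     \<i> ^ Suc n * cis (\<omega> * x) * fint (bump ([:\<omega>, 1:] ^ Suc n) 0) x) (at x)"
    using has_vector_derivative_mult[OF 1 fint_has_derivative[OF u]]
    unfolding eq by (simp add: algebra_simps)
  then have "((\<lambda>x. Re (\<i> ^ n * cis (\<omega> * x) * fint u x)) has_vector_derivative
     Re (\<i> ^ Suc n * cis (\<omega> * x) * fint (bump ([:\<omega>, 1:] ^ Suc n) 0) x)) (at x)"
    by (rule bounded_linear.has_vector_derivative[OF bounded_linear_Re])
  then show "(wave \<omega> n has_real_derivative wave \<omega> (Suc n) x) (at x)"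
    unfolding wave_def[abs_def] u_def has_real_derivative_iff_has_vector_derivative .
next
  fix n k
  obtain B where B: "\<And>x. norm (of_real x ^ k * fint (bump ([:\<omega>, 1:] ^ n) 0) x) \<le> B"
    using fint_bump_decay[of k "[:\<omega>, 1:] ^ n" 0] by (auto simp: bounded_iff)
  have "norm (x ^ k * wave \<omega> n x) \<le> B" for x
  proof -
    have "norm (wave \<omega> n x) \<le> norm (\<i> ^ n * cis (\<omega> * x) * fint (bump ([:\<omega>, 1:] ^ n) 0) x)"
      unfolding wave_def real_norm_def by (rule abs_Re_le_cmod)
    also have "\<dots> = norm (fint (bump ([:\<omega>, 1:] ^ n) 0) x)"
      by (simp add: norm_mult norm_power)
    finally have "norm (x ^ k * wave \<omega> n x) \<le> norm (of_real x ^ k * fint (bump ([:\<omega>, 1:] ^ n) 0) x)"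
      by (simp add: norm_mult norm_power abs_mult power_abs mult_left_mono)
    then show ?thesis using B order_trans by blast
  qed
  then show "bounded (range (\<lambda>x. x ^ k * wave \<omega> n x))" unfolding bounded_iff by blast
qed

lemma wave_0_0_fourier:
  assumes "\<bar>\<theta>\<bar> > 1"
  shows "(\<integral>x. of_real (wave 0 0 x) * cis (- (\<theta> * x)) \<partial>lborel) = 0"
proof -
  \<comment> \<open>The division is harmless because \<theta> lies outside the interval, so \<psi>
    and its derivative stay continuous.\<close>
  define \<psi> where "\<psi> = (\<lambda>s. bump 1 0 s / (s - \<theta>))"
  obtain q where q: "\<And>s. \<bar>s\<bar> < 1 \<Longrightarrow> (bump 1 0 has_real_derivative bump q 2 s) (at s)"
    using bump_has_derivative_inside[of _ 1 0] unfolding add_0 by blast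
  define \<psi>' where "\<psi>' = (\<lambda>s. bump q 2 s / (s - \<theta>) - bump 1 0 s / (s - \<theta>)\<^sup>2)"
  have nz: "s - \<theta> \<noteq> 0" if "s \<in> {-1..1}" for s using that assms by auto
  have c1: "continuous_on {-1..1} \<psi>" and c2: "continuous_on {-1..1} \<psi>'"
    unfolding \<psi>_def \<psi>'_def using nz by (auto intro!: continuous_intros continuous_on_bump)
  have d: "(\<psi> has_real_derivative \<psi>' s) (at s)" if "\<bar>s\<bar> < 1" for s
  proof -
    have ne: "s - \<theta> \<noteq> 0" using assms that by auto
    show ?thesis
      unfolding \<psi>_def \<psi>'_def
      by (rule derivative_eq_intros q that ne refl)+
        (use ne in \<open>simp add: diff_divide_distrib power2_eq_square\<close>)
  qed
  have parts: "\<i> * of_real x * fint \<psi> x = - fint \<psi>' x" for x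
    by (rule fint_by_parts[OF c1 c2 d]) (auto simp: \<psi>_def bump_def)
  obtain B where B: "\<And>s. s \<in> {-1..1} \<Longrightarrow> \<bar>\<psi>' s\<bar> \<le> B"
    using compact_imp_bounded[OF compact_continuous_image[OF c2 compact_Icc]] by (fastforce simp: bounded_iff)
  \<comment> \<open>A single integration by parts gives enough decay for the primitive
    \<open>K\<close> to vanish at both ends of the line.\<close>
  have decay: "norm (fint \<psi> x) \<le> 2 * B / \<bar>x\<bar>" if "x \<noteq> 0" for x
  proof -
    have "\<bar>x\<bar> * norm (fint \<psi> x) = norm (fint \<psi>' x)"
      using arg_cong[OF parts[of x], of norm] by (simp add: norm_mult)
    also have "\<dots> \<le> 2 * B" by (rule norm_fint_le[OF c2 B])
    finally show ?thesis using that by (simp add: field_simps)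
  qed
  define K where "K = (\<lambda>x. - \<i> * cis (- (\<theta> * x)) * fint \<psi> x)"
  have nK: "norm (K x) = norm (fint \<psi> x)" for x by (simp add: K_def norm_mult)
  have ev: "\<forall>\<^sub>F x in at_top. norm (K x) \<le> 2 * B / \<bar>x\<bar>" "\<forall>\<^sub>F x in at_bot. norm (K x) \<le> 2 * B / \<bar>x\<bar>"
    unfolding nK
    by (rule eventually_mono[OF eventually_gt_at_top[of 0]] eventually_mono[OF eventually_gt_at_bot[of 0]]; rule decay; simp)+
  have "((\<lambda>x. 2 * B / \<bar>x\<bar>) \<longlongrightarrow> 0) at_top" "((\<lambda>x. 2 * B / \<bar>x\<bar>) \<longlongrightarrow> 0) at_bot"
    by real_asymp+
  then have lim: "(K \<longlongrightarrow> 0) at_top" "(K \<longlongrightarrow> 0) at_bot"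
    using ev by (auto intro: Lim_null_comparison)
  have dK: "(K has_vector_derivative of_real (wave 0 0 x) * cis (- (\<theta> * x))) (at x)" for x
  proof -
    \<comment> \<open>Multiplying \<psi> by \<open>s - \<theta>\<close> recovers the bump: the part
      with \<open>s\<close> comes from differentiating \<open>fint \<psi>\<close>, the part with
      \<theta> from differentiating \<open>cis\<close>.\<close>
    have "fint (bump 1 0) x = fint (\<lambda>s. s * \<psi> s + (- \<theta>) * \<psi> s) x"
    proof (rule fint_cong)
      fix s :: real assume "s \<in> {-1..1}"
      then have "bump 1 0 s = (s - \<theta>) * \<psi> s" using nz[of s] by (simp add: \<psi>_def)
      then show "bump 1 0 s = s * \<psi> s + (- \<theta>) * \<psi> s" by (simp add: left_diff_distrib)
    qed
    also have "\<dots> = fint (\<lambda>s. s * \<psi> s) x - of_real \<theta> * fint \<psi> x"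
      using c1 fint_cmult[of "- \<theta>" \<psi> x] by (subst fint_add) (auto intro!: continuous_intros)
    finally have eq: "fint (bump 1 0) x = fint (\<lambda>s. s * \<psi> s) x - of_real \<theta> * fint \<psi> x" .
    have 1: "((\<lambda>x. - \<i> * cis (- (\<theta> * x))) has_vector_derivative - of_real \<theta> * cis (- (\<theta> * x))) (at x)"
      unfolding cis_conv_exp
      by (auto intro!: derivative_eq_intros has_vector_derivative_real_field simp: algebra_simps)
    show ?thesis
      using has_vector_derivative_mult[OF 1 fint_has_derivative[OF c1]]
      unfolding K_def wave_0_0 eq by (simp add: algebra_simps)
  qed
  show ?thesis
  proof (rule integral_deriv_eq_0[OF dK])
    show "continuous_on UNIV (\<lambda>x. of_real (wave 0 0 x) * cis (- (\<theta> * x)))"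
      by (intro continuous_intros schwartz_seq_continuous[OF schwartz_seq_wave])
    show "integrable lborel (\<lambda>x. of_real (wave 0 0 x) * cis (- (\<theta> * x)))"
      by (rule schwartz_seq_integrable_mult[OF schwartz_seq_wave, where B=1])
        (auto intro!: borel_measurable_continuous_onI continuous_intros)
  qed (fact lim)+
qed

text \<open>The cosine is half the sum of two exponentials, which shift the frequency of the
  envelope by \<omega> in either direction.\<close>

lemma wave_fourier:
  assumes "\<bar>\<eta> - \<omega>\<bar> > 1" "\<bar>\<eta> + \<omega>\<bar> > 1"
  shows "(\<integral>x. of_real (wave \<omega> 0 x) * cis (- (\<eta> * x)) \<partial>lborel) = 0"
proof -
  have eq: "of_real (wave \<omega> 0 x) * cis (- (\<eta> * x)) =
     (1 / 2) * (of_real (wave 0 0 x) * cis (- ((\<eta> - \<omega>) * x))) +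
     (1 / 2) * (of_real (wave 0 0 x) * cis (- ((\<eta> + \<omega>) * x)))" for x
    unfolding wave_0[of \<omega>]
    by (simp add: complex_eq_iff cos_add sin_add cos_diff sin_diff algebra_simps add_divide_distrib diff_divide_distrib)
  have int: "integrable lborel (\<lambda>x. of_real (wave 0 0 x) * cis (- (\<theta> * x)))" for \<theta>
    by (rule schwartz_seq_integrable_mult[OF schwartz_seq_wave, where B=1])
      (auto intro!: borel_measurable_continuous_onI continuous_intros)
  show ?thesis unfolding eq using int[of "\<eta> - \<omega>"] int[of "\<eta> + \<omega>"] assms
    by (simp add: wave_0_0_fourier)
qed

text \<open>The value at 0 is the integral of the bump, which is continuous, nonnegative and
  positive at 0.\<close>

lemma wave_0_0_at_0: "wave 0 0 0 \<noteq> 0"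
proof
  assume "wave 0 0 0 = 0"
  then have "fint (bump 1 0) 0 = 0" using wave_0_0[of 0] by simp
  then have "integral {-1..1} (\<lambda>s. complex_of_real (bump 1 0 s)) = 0" by (simp add: fint_def)
  moreover have "((\<lambda>s. complex_of_real (bump 1 0 s)) has_integral of_real (integral {-1..1} (bump 1 0))) {-1..1}"
    by (intro has_integral_of_real integrable_integral integrable_continuous_real continuous_on_bump)
  ultimately have 0: "integral {-1..1} (bump 1 0) = 0"
    by (metis integral_unique of_real_eq_0_iff)
  have nonneg: "bump 1 0 s \<ge> 0" for s by (simp add: bump_def)
  have "bump 1 0 0 = 0"
    using integral_cbox_eq_0_iff[of "-1" 1 "bump 1 0"] nonneg 0 by (simp add: continuous_on_bump)
  then show False by (simp add: bump_def)
qed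

text \<open>Four derivatives multiply the integrand by \<open>(\<omega> + s) ^ 4\<close>. Beyond
  \<open>\<omega> ^ 4\<close> the coefficients are 4, 6, 4, 1, with sum 15, and each term is at most
  its coefficient times \<open>\<omega> ^ 3\<close>; the interval has length 2.\<close>

lemma wave_4_approx:
  assumes \<omega>: "\<omega> \<ge> 1"
  shows "\<bar>wave \<omega> 4 x - \<omega> ^ 4 * wave \<omega> 0 x\<bar> \<le> 30 * \<omega> ^ 3"
proof -
  define r where "r = (\<lambda>s. (4 * \<omega> ^ 3 * s + 6 * \<omega>\<^sup>2 * s\<^sup>2 + 4 * \<omega> * s ^ 3 + s ^ 4) * bump 1 0 s)"
  have r: "continuous_on {-1..1} r"
    unfolding r_def by (intro continuous_intros continuous_on_bump)
  have "fint (bump ([:\<omega>, 1:] ^ 4) 0) x = fint (\<lambda>s. \<omega> ^ 4 * bump 1 0 s + r s) x"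
  proof (rule fint_cong)
    fix s :: real
    have "(\<omega> + s) ^ 4 = \<omega> ^ 4 + (4 * \<omega> ^ 3 * s + 6 * \<omega>\<^sup>2 * s\<^sup>2 + 4 * \<omega> * s ^ 3 + s ^ 4)"
      by (simp add: algebra_simps power4_eq_xxxx power3_eq_cube power2_eq_square)
    then have "bump ([:\<omega>, 1:] ^ 4) 0 s = (\<omega> ^ 4 + (4 * \<omega> ^ 3 * s + 6 * \<omega>\<^sup>2 * s\<^sup>2 + 4 * \<omega> * s ^ 3 + s ^ 4)) * bump 1 0 s"
      by (simp add: bump_def)
    then show "bump ([:\<omega>, 1:] ^ 4) 0 s = \<omega> ^ 4 * bump 1 0 s + r s"
      by (simp add: r_def algebra_simps)
  qed
  also have "\<dots> = of_real (\<omega> ^ 4) * fint (bump 1 0) x + fint r x"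
    using r by (subst fint_add) (auto intro!: continuous_intros continuous_on_bump simp: fint_cmult simp del: of_real_power)
  finally have eq: "fint (bump ([:\<omega>, 1:] ^ 4) 0) x = of_real (\<omega> ^ 4) * fint (bump 1 0) x + fint r x" .
  have "wave \<omega> 4 x = Re (of_real (\<omega> ^ 4) * (cis (\<omega> * x) * fint (bump 1 0) x) + cis (\<omega> * x) * fint r x)"
    unfolding wave_def eq by (simp add: algebra_simps)
  then have "wave \<omega> 4 x - \<omega> ^ 4 * wave \<omega> 0 x = Re (cis (\<omega> * x) * fint r x)"
    by (simp add: wave_def)
  also have "\<bar>\<dots>\<bar> \<le> norm (fint r x)"
    using abs_Re_le_cmod[of "cis (\<omega> * x) * fint r x"] by (simp add: norm_mult)
  also have "\<dots> \<le> 2 * (15 * \<omega> ^ 3)"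
  proof (rule norm_fint_le[OF r])
    fix s :: real assume "s \<in> {-1..1}"
    then have s: "\<bar>s\<bar> \<le> 1" by auto
    have w: "\<omega> ^ 0 \<le> \<omega> ^ 3" "\<omega> ^ 1 \<le> \<omega> ^ 3" "\<omega> ^ 2 \<le> \<omega> ^ 3" using \<omega> by (intro power_increasing; simp)+
    have sp: "\<bar>s ^ k\<bar> \<le> 1" for k using s by (simp add: power_abs power_le_one)
    have "\<bar>4 * \<omega> ^ 3 * s + 6 * \<omega>\<^sup>2 * s\<^sup>2 + 4 * \<omega> * s ^ 3 + s ^ 4\<bar>
       \<le> 4 * \<omega> ^ 3 * \<bar>s ^ 1\<bar> + 6 * \<omega>\<^sup>2 * \<bar>s\<^sup>2\<bar> + 4 * \<omega> * \<bar>s ^ 3\<bar> + \<bar>s ^ 4\<bar>"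
      using \<omega> by (intro order_trans[OF abs_triangle_ineq] add_mono) (auto simp: abs_mult)
    also have "\<dots> \<le> 4 * \<omega> ^ 3 * 1 + 6 * \<omega>\<^sup>2 * 1 + 4 * \<omega> * 1 + 1"
      using \<omega> by (intro add_mono mult_left_mono sp) auto
    also have "\<dots> \<le> 15 * \<omega> ^ 3" using w by simp
    finally have 1: "\<bar>4 * \<omega> ^ 3 * s + 6 * \<omega>\<^sup>2 * s\<^sup>2 + 4 * \<omega> * s ^ 3 + s ^ 4\<bar> \<le> 15 * \<omega> ^ 3" .
    have "\<bar>bump 1 0 s\<bar> \<le> 1"
      by (auto simp: bump_def abs_square_less_1 intro: less_imp_le)
    then show "\<bar>r s\<bar> \<le> 15 * \<omega> ^ 3"
      unfolding r_def abs_mult[of _ "bump 1 0 s"]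
      using mult_mono[OF 1, of "\<bar>bump 1 0 s\<bar>" 1] \<omega> by simp
  qed
  finally show ?thesis by simp
qed

subsection \<open>Negativity in one dimension\<close>

text \<open>A periodic factor of mean zero has a bounded primitive, so integrating by parts against
  it gains \<open>1 / K\<close>; the 4 comes from differentiating the fourth power of
  \<open>P 0\<close>.\<close>

lemma oscillatory_integral_bound:
  fixes H h :: "real \<Rightarrow> real"
  assumes P: "schwartz_seq P" and H: "\<And>x. (H has_real_derivative h x) (at x)"
    and h: "continuous_on UNIV h" and HM: "\<And>x. \<bar>H x\<bar> \<le> M" and hM: "\<And>x. \<bar>h x\<bar> \<le> M'" and K: "K > 0"
  shows "\<bar>\<integral>x. P 0 x * (P 0 x ^ 3 * h (K * x)) \<partial>lborel\<bar> \<le> 4 * M / K * (\<integral>x. \<bar>P 1 x * P 0 x ^ 3\<bar> \<partial>lborel)"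
proof -
  have Hc: "continuous_on UNIV H" using H DERIV_isCont by (blast intro: continuous_at_imp_continuous_on)
  obtain C where C: "C \<ge> 0" "\<And>x. \<bar>P 0 x\<bar> \<le> C" using schwartz_seq_bounded[OF P] by blast
  have C3: "\<bar>P 0 x ^ 3\<bar> \<le> C ^ 3" for x using C by (simp add: power_abs power_mono)
  have M: "M \<ge> 0" "M' \<ge> 0" using HM[of 0] hM[of 0] by linarith+
  have cont: "continuous_on UNIV (\<lambda>x. P 0 x ^ 3 * H (K * x))" "continuous_on UNIV (\<lambda>x. P 0 x ^ 3 * h (K * x))"
    by (intro continuous_intros schwartz_seq_continuous[OF P] continuous_on_compose2[OF Hc]
        continuous_on_compose2[OF h]; simp)+
  have bd: "norm (P 0 x ^ 3 * h (K * x)) \<le> C ^ 3 * M'" "norm (P 0 x ^ 3 * H (K * x)) \<le> C ^ 3 * M" for x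
    unfolding real_norm_def abs_mult by (intro mult_mono C3 HM hM; use C(1) in simp)+
  have i1: "integrable lborel (\<lambda>x. P 0 x * (P 0 x ^ 3 * h (K * x)))"
    using schwartz_seq_integrable_mult[OF P borel_measurable_continuous_onI[OF cont(2)] bd(1), of 0] by simp
  have i2: "integrable lborel (\<lambda>x. P 1 x * (P 0 x ^ 3 * H (K * x)))"
    using schwartz_seq_integrable_mult[OF P borel_measurable_continuous_onI[OF cont(1)] bd(2), of 1] by simp
  have i3: "integrable lborel (\<lambda>x. P 1 x * P 0 x ^ 3)" by (rule schwartz_seq_integrable_power[OF P])
  \<comment> \<open>This is the derivative of \<open>P 0 x ^ 4 * H (K * x) / K\<close>.\<close>
  define k where "k = (\<lambda>x. P 0 x * (P 0 x ^ 3 * h (K * x)) + (4 / K) * (P 1 x * (P 0 x ^ 3 * H (K * x))))"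
  have "(\<integral>x. k x \<partial>lborel) = 0"
  proof (rule integral_deriv_eq_0)
    fix x
    have Kk: "K * k x = K * (P 0 x * (P 0 x ^ 3 * h (K * x))) + 4 * (P (Suc 0) x * (P 0 x ^ 3 * H (K * x)))"
      unfolding k_def using K by (simp add: distrib_left)
    have "((\<lambda>x. P 0 x * (P 0 x ^ 3 * H (K * x))) has_real_derivative K * k x) (at x)"
      by (rule derivative_eq_intros DERIV_chain2[OF H] schwartz_seq_deriv[OF P] refl)+
        (simp add: Kk algebra_simps power2_eq_square power3_eq_cube)
    from DERIV_cdivide[OF this, of K]
    have "((\<lambda>x. P 0 x * (P 0 x ^ 3 * H (K * x)) / K) has_real_derivative k x) (at x)"
      using K by simp
    then show "((\<lambda>x. P 0 x * (P 0 x ^ 3 * H (K * x)) / K) has_vector_derivative k x) (at x)"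
      by (simp add: has_real_derivative_iff_has_vector_derivative)
  next
    show "continuous_on UNIV k" unfolding k_def
      by (intro continuous_intros cont schwartz_seq_continuous[OF P])
    show "integrable lborel k" unfolding k_def using i1 i2 by simp
    have le: "norm (P 0 x * (P 0 x ^ 3 * H (K * x)) / K) \<le> norm (P 0 x) * (C ^ 3 * M / K)" for x
    proof -
      have "norm (P 0 x * (P 0 x ^ 3 * H (K * x)) / K) = norm (P 0 x) * (norm (P 0 x ^ 3 * H (K * x)) / K)"
        using K by (simp add: abs_mult)
      also have "\<dots> \<le> norm (P 0 x) * (C ^ 3 * M / K)"
        using bd(2) K by (intro mult_left_mono divide_right_mono) auto
      finally show ?thesis .
    qed
    show "((\<lambda>x. P 0 x * (P 0 x ^ 3 * H (K * x)) / K) \<longlongrightarrow> 0) at_top"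
      "((\<lambda>x. P 0 x * (P 0 x ^ 3 * H (K * x)) / K) \<longlongrightarrow> 0) at_bot"
      by (rule tendsto_0_le[OF schwartz_seq_tendsto_0(1)[OF P, of 0] always_eventually[OF allI[OF le]]]
          tendsto_0_le[OF schwartz_seq_tendsto_0(2)[OF P, of 0] always_eventually[OF allI[OF le]]])+
  qed
  then have "(\<integral>x. P 0 x * (P 0 x ^ 3 * h (K * x)) \<partial>lborel) = - (4 / K) * (\<integral>x. P 1 x * (P 0 x ^ 3 * H (K * x)) \<partial>lborel)"
    unfolding k_def using i1 i2 by simp
  moreover have "\<bar>\<integral>x. P 1 x * (P 0 x ^ 3 * H (K * x)) \<partial>lborel\<bar> \<le> (\<integral>x. M * \<bar>P 1 x * P 0 x ^ 3\<bar> \<partial>lborel)"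
  proof (rule order_trans[OF integral_abs_bound], rule integral_mono)
    fix x
    have "\<bar>P 1 x * P 0 x ^ 3\<bar> * \<bar>H (K * x)\<bar> \<le> \<bar>P 1 x * P 0 x ^ 3\<bar> * M"
      using HM by (intro mult_left_mono) auto
    then show "\<bar>P 1 x * (P 0 x ^ 3 * H (K * x))\<bar> \<le> M * \<bar>P 1 x * P 0 x ^ 3\<bar>"
      by (simp add: abs_mult mult_ac)
  qed (use i2 i3 in auto)
  ultimately have "\<bar>\<integral>x. P 0 x * (P 0 x ^ 3 * h (K * x)) \<partial>lborel\<bar> \<le> (4 / K) * (\<integral>x. M * \<bar>P 1 x * P 0 x ^ 3\<bar> \<partial>lborel)"
    using K by (simp only: abs_mult) (intro mult_mono; simp)
  then show ?thesis by simp
qed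

text \<open>With \<open>c = cos t\<close>, the coefficients solve \<open>c P c - (1 - c\<^sup>2) P' c = g'''' g\<^sup>3 + 439 / 6144\<close>, so that
  \<open>sin t P (cos t)\<close> is a primitive of \<open>g'''' g\<^sup>3\<close> minus its mean value \<open>- 439 / 6144\<close>.\<close>

definition trig_prim :: "real \<Rightarrow> real" where
  "trig_prim t = sin t * (cos t ^ 11 / 12 - 1201 / 1080 * cos t ^ 9 + 1231 / 240 * cos t ^ 7
     - 1501 / 180 * cos t ^ 5 - 439 / 9216 * cos t ^ 3 - 439 / 6144 * cos t)"

lemma cos_triple: "cos (3 * t) = 4 * cos t ^ 3 - 3 * cos t" for t :: real
proof -
  have "cos (3 * t) = cos (2 * t + t)" by simp
  also have "\<dots> = (2 * (cos t)\<^sup>2 - 1) * cos t - 2 * (sin t)\<^sup>2 * cos t"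
    by (simp only: cos_add cos_double_cos sin_double) (simp add: power2_eq_square)
  also have "\<dots> = 4 * cos t ^ 3 - 3 * cos t"
    unfolding sin_squared_eq by (simp add: algebra_simps power2_eq_square power3_eq_cube)
  finally show ?thesis .
qed

text \<open>The coefficient \<open>81 / 12\<close> is \<open>3 ^ 4 / 12\<close>, so the first factor
  is \<open>g''''\<close>. After the triple angle formula both sides are polynomials in
  \<open>cos t\<close>.\<close>

lemma trig_prim_deriv:
  "(trig_prim has_real_derivative
     (cos t - 81 / 12 * cos (3 * t)) * (cos t - cos (3 * t) / 12) ^ 3 + 439 / 6144) (at t)"
proof -
  define c s where "c = cos t" and "s = sin t"
  define P where "P = (\<lambda>c::real. c ^ 11 / 12 - 1201 / 1080 * c ^ 9 + 1231 / 240 * c ^ 7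
     - 1501 / 180 * c ^ 5 - 439 / 9216 * c ^ 3 - 439 / 6144 * c)"
  define P' where "P' = (\<lambda>c::real. 11 * c ^ 10 / 12 - 9 * (1201 / 1080) * c ^ 8 + 7 * (1231 / 240) * c ^ 6
     - 5 * (1501 / 180) * c ^ 4 - 3 * (439 / 9216) * c ^ 2 - 439 / 6144)"
  have P: "(P has_real_derivative P' c) (at c)" for c
    unfolding P_def P'_def by (auto intro!: derivative_eq_intros)
  have "((\<lambda>t. sin t * P (cos t)) has_real_derivative c * P c - s\<^sup>2 * P' c) (at t)"
    by (rule derivative_eq_intros DERIV_chain2[OF P] refl)+ (simp add: c_def s_def power2_eq_square)
  also have "c * P c - s\<^sup>2 * P' c = c * P c - (1 - c\<^sup>2) * P' c"
    by (simp add: c_def s_def sin_squared_eq)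
  also have "\<dots> = (c - 81 / 12 * (4 * c ^ 3 - 3 * c)) * (c - (4 * c ^ 3 - 3 * c) / 12) ^ 3 + 439 / 6144"
    unfolding P_def P'_def by (simp add: field_simps) algebra
  finally show ?thesis
    by (simp add: trig_prim_def[abs_def] P_def c_def cos_triple)
qed

text \<open>The absolute values of the coefficients sum to less than 15.\<close>

lemma trig_prim_bound: "\<bar>trig_prim t\<bar> \<le> 20"
proof -
  have sc: "\<bar>sin t\<bar> \<le> 1" "\<bar>cos t ^ k\<bar> \<le> 1" for k
    by (auto simp: power_abs power_le_one)
  have "\<bar>cos t ^ 11 / 12 - 1201 / 1080 * cos t ^ 9 + 1231 / 240 * cos t ^ 7
     - 1501 / 180 * cos t ^ 5 - 439 / 9216 * cos t ^ 3 - 439 / 6144 * cos t\<bar> \<le> 20"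
    using sc(2)[of 11] sc(2)[of 9] sc(2)[of 7] sc(2)[of 5] sc(2)[of 3] sc(2)[of 1]
    unfolding abs_le_iff power_one_right by linarith
  then have "\<bar>sin t\<bar> * \<bar>cos t ^ 11 / 12 - 1201 / 1080 * cos t ^ 9 + 1231 / 240 * cos t ^ 7
     - 1501 / 180 * cos t ^ 5 - 439 / 9216 * cos t ^ 3 - 439 / 6144 * cos t\<bar> \<le> 1 * 20"
    using sc(1) by (intro mult_mono) auto
  then show ?thesis by (simp add: trig_prim_def abs_mult)
qed

text \<open>The \<open>n\<close>-th derivative of the packet \<open>G\<close> of the
  overview.\<close>

definition wave_pair :: "real \<Rightarrow> nat \<Rightarrow> real \<Rightarrow> real" where
  "wave_pair K n x = wave K n x + (- 1 / 12) * wave (3 * K) n x"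

lemma schwartz_seq_wave_pair: "schwartz_seq (wave_pair K)"
  unfolding wave_pair_def[abs_def]
  using schwartz_seq_lincomb[OF schwartz_seq_wave schwartz_seq_wave] .

lemma wave_pair_0: "wave_pair K 0 x = (cos (K * x) - cos (3 * (K * x)) / 12) * wave 0 0 x"
  unfolding wave_pair_def wave_0[of K] wave_0[of "3 * K"] by (simp add: algebra_simps)

text \<open>To leading order the derivatives fall on the cosines alone. The two errors add up to
  \<open>30 + 30 * 27 / 12 = 97.5\<close> times \<open>K ^ 3\<close>.\<close>

lemma wave_pair_4:
  assumes "K \<ge> 1"
  shows "\<bar>wave_pair K 4 x - K ^ 4 * ((cos (K * x) - 81 / 12 * cos (3 * (K * x))) * wave 0 0 x)\<bar> \<le> 100 * K ^ 3"
proof -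
  have "wave_pair K 4 x - K ^ 4 * ((cos (K * x) - 81 / 12 * cos (3 * (K * x))) * wave 0 0 x) =
    (wave K 4 x - K ^ 4 * wave K 0 x) - (wave (3 * K) 4 x - (3 * K) ^ 4 * wave (3 * K) 0 x) / 12"
    unfolding wave_pair_def wave_0[of K] wave_0[of "3 * K"] by (simp add: field_simps power_mult_distrib)
  also have "\<bar>\<dots>\<bar> \<le> \<bar>wave K 4 x - K ^ 4 * wave K 0 x\<bar> +
      \<bar>wave (3 * K) 4 x - (3 * K) ^ 4 * wave (3 * K) 0 x\<bar> / 12"
    by (rule order_trans[OF abs_triangle_ineq4]) (simp add: abs_divide)
  also have "\<dots> \<le> 30 * K ^ 3 + (30 * (3 * K) ^ 3) / 12"
    using assms by (intro add_mono divide_right_mono wave_4_approx) auto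
  also have "\<dots> \<le> 100 * K ^ 3" using assms by (simp add: power_mult_distrib)
  finally show ?thesis .
qed

text \<open>The spectrum lies within distance 1 of the four frequencies \<open>K\<close>,
  \<open>- K\<close>, \<open>3 * K\<close> and \<open>- 3 * K\<close>.\<close>

lemma wave_pair_fourier:
  assumes "K \<ge> 1" "\<bar>\<eta>\<bar> < K - 1 \<or> \<bar>\<eta>\<bar> > 3 * K + 1"
  shows "(\<integral>x. of_real (wave_pair K 0 x) * cis (- (\<eta> * x)) \<partial>lborel) = 0"
proof -
  have int: "integrable lborel (\<lambda>x. of_real (wave \<omega> 0 x) * cis (- (\<eta> * x)))" for \<omega>
    by (rule schwartz_seq_integrable_mult[OF schwartz_seq_wave, where B=1])
      (auto intro!: borel_measurable_continuous_onI continuous_intros)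
  have eq: "of_real (wave_pair K 0 x) * cis (- (\<eta> * x)) = of_real (wave K 0 x) * cis (- (\<eta> * x)) -
      (1 / 12) * (of_real (wave (3 * K) 0 x) * cis (- (\<eta> * x)))" for x
    by (simp add: wave_pair_def algebra_simps)
  have "(\<integral>x. of_real (wave K 0 x) * cis (- (\<eta> * x)) \<partial>lborel) = 0"
    "(\<integral>x. of_real (wave (3 * K) 0 x) * cis (- (\<eta> * x)) \<partial>lborel) = 0"
    using assms by (intro wave_fourier; linarith)+
  then show ?thesis unfolding eq using int by simp
qed

text \<open>The mean of the periodic factor contributes a negative multiple of \<open>K ^ 4\<close>.
  Its oscillating part and the derivatives of the envelope contribute only multiples of
  \<open>K ^ 3\<close>, so a large \<open>K\<close> decides the sign.\<close>

lemma wave_pair_negative: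
  "\<exists>K>2. (\<integral>x. wave_pair K 4 x * wave_pair K 0 x ^ 3 \<partial>lborel) < 0"
proof -
  define P where "P = wave 0"
  have P: "schwartz_seq P" unfolding P_def by (rule schwartz_seq_wave)
  define g g4 where "g = (\<lambda>t::real. cos t - cos (3 * t) / 12)" and "g4 = (\<lambda>t::real. cos t - 81 / 12 * cos (3 * t))"
  define h where "h = (\<lambda>t. g4 t * g t ^ 3 + 439 / 6144)"
  have dH: "(trig_prim has_real_derivative h t) (at t)" for t
    using trig_prim_deriv[of t] by (simp only: h_def g_def g4_def)
  have gb: "\<bar>g t\<bar> \<le> 2" "\<bar>g4 t\<bar> \<le> 8" for t
    using abs_cos_le_one[of t] abs_cos_le_one[of "3 * t"] unfolding g_def g4_def abs_le_iff by (simp; linarith)+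
  have g3b: "\<bar>g t ^ 3\<bar> \<le> 8" for t
    using power_mono[OF gb(1), of t 3] by (simp add: power_abs)
  have hb: "\<bar>h t\<bar> \<le> 65" for t
  proof -
    have "\<bar>g4 t * g t ^ 3\<bar> \<le> 8 * 8" unfolding abs_mult using gb g3b by (intro mult_mono) auto
    then show ?thesis unfolding h_def abs_le_iff by linarith
  qed
  have gc: "continuous_on A g" "continuous_on A g4" for A unfolding g_def g4_def by (intro continuous_intros; simp)+
  have hc: "continuous_on UNIV h" unfolding h_def by (intro continuous_intros gc)
  define A4 A3 B where "A4 = (\<integral>x. P 0 x * P 0 x ^ 3 \<partial>lborel)"
    and "A3 = (\<integral>x. \<bar>P 0 x * P 0 x ^ 2\<bar> \<partial>lborel)" and "B = (\<integral>x. \<bar>P 1 x * P 0 x ^ 3\<bar> \<partial>lborel)"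
  have A4: "A4 > 0"
    unfolding A4_def by (rule schwartz_seq_fourth_moment_pos[OF P, of 0]) (use wave_0_0_at_0 in \<open>simp add: P_def\<close>)
  have nn: "A3 \<ge> 0" "B \<ge> 0" unfolding A3_def B_def by (auto intro: Bochner_Integration.integral_nonneg)
  \<comment> \<open>Here \<open>80 = 4 * 20\<close> combines
    \<open>oscillatory_integral_bound\<close> with \<open>trig_prim_bound\<close>, and
    \<open>800 = 100 * 8\<close> combines \<open>wave_pair_4\<close> with the bound on
    \<open>g ^ 3\<close>. The summand 3 makes the next inequality strict and keeps \<open>K\<close>
    above 2.\<close>
  define K where "K = 3 + (80 * B + 800 * A3) / (439 / 6144 * A4)"
  have K: "K \<ge> 3" unfolding K_def using nn A4 by simp
  have Kc: "K * (439 / 6144 * A4) > 80 * B + 800 * A3"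
    unfolding K_def using A4 by (simp add: field_simps)
  define G4 G where "G4 = wave_pair K 4" and "G = wave_pair K 0"
  have G: "G x = g (K * x) * P 0 x" for x unfolding G_def wave_pair_0 g_def P_def ..
  define R where "R = (\<lambda>x. G4 x - K ^ 4 * (g4 (K * x) * P 0 x))"
  have R: "\<bar>R x\<bar> \<le> 100 * K ^ 3" for x
    using wave_pair_4[of K x] K unfolding R_def G4_def g4_def P_def by simp
  have G4c: "continuous_on UNIV G4" unfolding G4_def by (rule schwartz_seq_continuous[OF schwartz_seq_wave_pair])
  have Rc: "continuous_on UNIV R"
    unfolding R_def by (intro continuous_intros G4c schwartz_seq_continuous[OF P] continuous_on_compose2[OF gc(2)[of UNIV]]; simp)
  obtain C where C: "C \<ge> 0" "\<And>x. \<bar>P 0 x\<bar> \<le> C" using schwartz_seq_bounded[OF P] by blast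
  \<comment> \<open>The three terms are the oscillating part, the mean, and the error
    \<open>R\<close> from derivatives of the envelope.\<close>
  have split: "G4 x * G x ^ 3 = K ^ 4 * (P 0 x * (P 0 x ^ 3 * h (K * x))) - K ^ 4 * (439 / 6144) * (P 0 x * P 0 x ^ 3)
      + P 0 x * (P 0 x ^ 2 * (R x * g (K * x) ^ 3))" for x
    unfolding G R_def h_def by (simp add: algebra_simps power2_eq_square power3_eq_cube)
  have C3: "\<bar>P 0 x ^ k\<bar> \<le> C ^ k" for x k using C by (simp add: power_abs power_mono)
  have i1: "integrable lborel (\<lambda>x. P 0 x * (P 0 x ^ 3 * h (K * x)))"
  proof -
    have c: "continuous_on UNIV (\<lambda>x. P 0 x ^ 3 * h (K * x))"
      by (intro continuous_intros schwartz_seq_continuous[OF P] continuous_on_compose2[OF hc]; simp)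
    have "norm (P 0 x ^ 3 * h (K * x)) \<le> C ^ 3 * 65" for x
      unfolding real_norm_def abs_mult by (intro mult_mono C3 hb; use C(1) in simp)
    from schwartz_seq_integrable_mult[OF P borel_measurable_continuous_onI[OF c] this, of 0] show ?thesis by simp
  qed
  have i2: "integrable lborel (\<lambda>x. P 0 x * P 0 x ^ 3)" by (rule schwartz_seq_integrable_power[OF P])
  have i4: "integrable lborel (\<lambda>x. P 0 x * P 0 x ^ 2)" by (rule schwartz_seq_integrable_power[OF P])
  have Rg: "\<bar>R x * g (K * x) ^ 3\<bar> \<le> 800 * K ^ 3" for x
    unfolding abs_mult using mult_mono[OF R[of x] g3b[of "K * x"]] K by simp
  have i3: "integrable lborel (\<lambda>x. P 0 x * (P 0 x ^ 2 * (R x * g (K * x) ^ 3)))"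
  proof -
    have c: "continuous_on UNIV (\<lambda>x. P 0 x ^ 2 * (R x * g (K * x) ^ 3))"
      by (intro continuous_intros Rc schwartz_seq_continuous[OF P] continuous_on_compose2[OF gc(1)[of UNIV]]; simp)
    have "norm (P 0 x ^ 2 * (R x * g (K * x) ^ 3)) \<le> C ^ 2 * (800 * K ^ 3)" for x
      unfolding real_norm_def abs_mult[of "_ ^ _"] by (intro mult_mono C3 Rg; use C(1) in simp)
    from schwartz_seq_integrable_mult[OF P borel_measurable_continuous_onI[OF c] this, of 0] show ?thesis by simp
  qed
  have "(\<integral>x. G4 x * G x ^ 3 \<partial>lborel) = K ^ 4 * (\<integral>x. P 0 x * (P 0 x ^ 3 * h (K * x)) \<partial>lborel)
      - K ^ 4 * (439 / 6144) * A4 + (\<integral>x. P 0 x * (P 0 x ^ 2 * (R x * g (K * x) ^ 3)) \<partial>lborel)"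
    unfolding split A4_def using i1 i2 i3 by simp
  also have "(\<integral>x. P 0 x * (P 0 x ^ 2 * (R x * g (K * x) ^ 3)) \<partial>lborel) \<le> (\<integral>x. 800 * K ^ 3 * \<bar>P 0 x * P 0 x ^ 2\<bar> \<partial>lborel)"
  proof (rule integral_mono[OF i3])
    fix x
    have "P 0 x * (P 0 x ^ 2 * (R x * g (K * x) ^ 3)) \<le> \<bar>P 0 x * P 0 x ^ 2\<bar> * \<bar>R x * g (K * x) ^ 3\<bar>"
      by (simp only: abs_mult[symmetric] mult.assoc abs_ge_self)
    also have "\<dots> \<le> \<bar>P 0 x * P 0 x ^ 2\<bar> * (800 * K ^ 3)" using Rg by (intro mult_left_mono) auto
    finally show "P 0 x * (P 0 x ^ 2 * (R x * g (K * x) ^ 3)) \<le> 800 * K ^ 3 * \<bar>P 0 x * P 0 x ^ 2\<bar>"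
      by (simp only: mult.commute)
  qed (use i4 in auto)
  also have "(\<integral>x. 800 * K ^ 3 * \<bar>P 0 x * P 0 x ^ 2\<bar> \<partial>lborel) = K ^ 3 * (800 * A3)"
    unfolding A3_def by simp
  also have "K ^ 4 * (\<integral>x. P 0 x * (P 0 x ^ 3 * h (K * x)) \<partial>lborel) \<le> K ^ 4 * (4 * 20 / K * B)"
  proof (rule mult_left_mono)
    have "\<bar>\<integral>x. P 0 x * (P 0 x ^ 3 * h (K * x)) \<partial>lborel\<bar> \<le> 4 * 20 / K * B"
      unfolding B_def using K
      by (intro oscillatory_integral_bound[OF P dH hc trig_prim_bound hb]) simp
    then show "(\<integral>x. P 0 x * (P 0 x ^ 3 * h (K * x)) \<partial>lborel) \<le> 4 * 20 / K * B" by linarith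
  qed (use K in simp)
  also have "K ^ 4 * (4 * 20 / K * B) = K ^ 3 * (80 * B)" using K by (simp add: power4_eq_xxxx power3_eq_cube)
  finally have "(\<integral>x. G4 x * G x ^ 3 \<partial>lborel) \<le> K ^ 3 * (80 * B + 800 * A3 - K * (439 / 6144 * A4))"
    by (simp add: algebra_simps power4_eq_xxxx power3_eq_cube)
  also have "\<dots> < 0" using K Kc by (intro mult_pos_neg) auto
  finally show ?thesis unfolding G4_def G_def using K by (intro exI[of _ K]) auto
qed

subsection \<open>Tensor products\<close>

text \<open>With \<open>F b\<close> a derivative sequence in the coordinate \<open>b\<close>, the
  function \<open>m\<close> is a multi-index and \<open>tensor F m\<close> is the partial derivative
  of that order of the product function.\<close>

definition tensor :: "('a::euclidean_space \<Rightarrow> nat \<Rightarrow> real \<Rightarrow> real) \<Rightarrow> ('a \<Rightarrow> nat) \<Rightarrow> 'a \<Rightarrow> real" where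
  "tensor F m x = (\<Prod>b\<in>Basis. F b (m b) (x \<bullet> b))"

abbreviation incr :: "'a \<Rightarrow> ('a \<Rightarrow> nat) \<Rightarrow> 'a \<Rightarrow> nat" where
  "incr c m \<equiv> m(c := Suc (m c))"

lemma tensor_has_derivative:
  assumes F: "\<And>b. schwartz_seq (F b)"
  shows "(tensor F m has_derivative (\<lambda>y. \<Sum>i\<in>Basis. (y \<bullet> i) * tensor F (incr i m) x)) (at x)"
proof -
  have "((\<lambda>x. \<Prod>b\<in>Basis. F b (m b) (x \<bullet> b)) has_derivative
     (\<lambda>y. \<Sum>i\<in>Basis. (F i (Suc (m i)) (x \<bullet> i) * (y \<bullet> i)) * (\<Prod>j\<in>Basis - {i}. F j (m j) (x \<bullet> j)))) (at x)"
  proof (rule has_derivative_prod)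
    fix i :: 'a
    have "(F i (m i) has_derivative (*) (F i (Suc (m i)) (x \<bullet> i))) (at (x \<bullet> i))"
      using schwartz_seq_deriv[OF F] by (simp add: has_field_derivative_def)
    from has_derivative_compose[where f="\<lambda>x. x \<bullet> i" and f'="\<lambda>y. y \<bullet> i", OF _ this]
    show "((\<lambda>x. F i (m i) (x \<bullet> i)) has_derivative (\<lambda>y. F i (Suc (m i)) (x \<bullet> i) * (y \<bullet> i))) (at x)"
      using bounded_linear_inner_left bounded_linear_imp_has_derivative by blast
  qed
  moreover have "(F i (Suc (m i)) (x \<bullet> i) * (y \<bullet> i)) * (\<Prod>j\<in>Basis - {i}. F j (m j) (x \<bullet> j)) =
      (y \<bullet> i) * tensor F (incr i m) x" if "i \<in> Basis" for i y :: 'a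
  proof -
    have "tensor F (incr i m) x = F i (Suc (m i)) (x \<bullet> i) * (\<Prod>j\<in>Basis - {i}. F j (incr i m j) (x \<bullet> j))"
      unfolding tensor_def using that by (subst prod.remove[of _ i]) auto
    also have "(\<Prod>j\<in>Basis - {i}. F j (incr i m j) (x \<bullet> j)) = (\<Prod>j\<in>Basis - {i}. F j (m j) (x \<bullet> j))"
      by (intro prod.cong) auto
    finally show ?thesis by (simp only: mult_ac)
  qed
  ultimately show ?thesis unfolding tensor_def[abs_def] by (simp cong: sum.cong)
qed

text \<open>Orthonormality of the basis leaves one term of the product rule. Finite sums are treated
  at once because the inner Laplacian already produces one.\<close>

lemma frechet_derivative_sum_tensor:
  assumes F: "\<And>b. schwartz_seq (F b)" and c: "c \<in> Basis"
  shows "frechet_derivative (\<lambda>x. \<Sum>a\<in>A. tensor F (m a) x) (at x) c = (\<Sum>a\<in>A. tensor F (incr c (m a)) x)"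
proof -
  have "((\<lambda>x. \<Sum>a\<in>A. tensor F (m a) x) has_derivative
      (\<lambda>y. \<Sum>a\<in>A. \<Sum>i\<in>Basis. (y \<bullet> i) * tensor F (incr i (m a)) x)) (at x)"
    by (intro has_derivative_sum tensor_has_derivative F)
  then have "frechet_derivative (\<lambda>x. \<Sum>a\<in>A. tensor F (m a) x) (at x) =
      (\<lambda>y. \<Sum>a\<in>A. \<Sum>i\<in>Basis. (y \<bullet> i) * tensor F (incr i (m a)) x)"
    by (rule frechet_derivative_at[symmetric])
  moreover have "(\<Sum>i\<in>Basis. (c \<bullet> i) * tensor F (incr i (m a)) x) = tensor F (incr c (m a)) x" for a
    using c by (simp add: inner_Basis if_distrib[of "\<lambda>t. t * _"] cong: if_cong)
  ultimately show ?thesis by simp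
qed

lemma frechet_derivative_tensor:
  assumes "\<And>b. schwartz_seq (F b)" "c \<in> Basis"
  shows "frechet_derivative (tensor F m) (at x) c = tensor F (incr c m) x"
  using frechet_derivative_sum_tensor[where F=F and A="{()}" and m="\<lambda>_. m", OF assms] by simp

text \<open>Partial derivatives never leave the family, so the Schwartz bounds need checking only
  for a single tensor.\<close>

lemma pderivs_tensor:
  assumes F: "\<And>b. schwartz_seq (F b)" and "set bs \<subseteq> Basis"
  shows "\<exists>m'. pderivs bs (tensor F m) = tensor F m'"
  using assms(2)
proof (induction bs)
  case Nil
  show ?case by (rule exI[of _ m]) (rule pderivs.simps)
next
  case (Cons c bs)
  then obtain m' where m': "pderivs bs (tensor F m) = tensor F m'" by auto
  have c: "c \<in> Basis" using Cons.prems by simp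
  have "pderivs (c # bs) (tensor F m) = tensor F (incr c m')"
    unfolding pderivs.simps m' by (rule ext) (rule frechet_derivative_tensor[where F=F, OF F c])
  then show ?case by (rule exI[of _ "incr c m'"])
qed

text \<open>Expanding the product and keeping the constant and linear terms. It bounds the norm by a
  product over the coordinates.\<close>

lemma sum_le_prod_one_plus:
  fixes a :: "'i \<Rightarrow> real"
  assumes "finite A" "\<And>i. i \<in> A \<Longrightarrow> a i \<ge> 0"
  shows "1 + (\<Sum>i\<in>A. a i) \<le> (\<Prod>i\<in>A. 1 + a i)"
  using assms
proof (induction A rule: finite_induct)
  case (insert x A)
  have "1 + (\<Sum>i\<in>insert x A. a i) \<le> (1 + a x) * (1 + (\<Sum>i\<in>A. a i))"
    using insert by (simp add: distrib_left distrib_right sum_nonneg)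
  also have "\<dots> \<le> (1 + a x) * (\<Prod>i\<in>A. 1 + a i)"
    using insert by (intro mult_left_mono) auto
  finally show ?case using insert by simp
qed simp

text \<open>The norm is at most the product of the \<open>1 + \<bar>x \<bullet> b\<bar>\<close>, so
  its \<open>k\<close>-th power splits over the coordinates and each factor absorbs its own
  share.\<close>

lemma schwartz_tensor:
  fixes F :: "'a::euclidean_space \<Rightarrow> nat \<Rightarrow> real \<Rightarrow> real"
  assumes F: "\<And>b. schwartz_seq (F b)"
  shows "schwartz (tensor F m)"
  unfolding schwartz_def
proof (intro allI impI)
  fix bs :: "'a list"
  assume "set bs \<subseteq> Basis"
  then obtain m' where m': "pderivs bs (tensor F m) = tensor F m'" using pderivs_tensor[where F=F, OF F] by blast
  have "bounded (range (\<lambda>x. norm x ^ k * tensor F m' x))" for k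
  proof -
    have "\<exists>C. \<forall>x. (1 + \<bar>x\<bar>) ^ k * \<bar>F b (m' b) x\<bar> \<le> C" for b
      using schwartz_seq_bounded_poly[OF F] by metis
    then obtain C where C: "\<And>b x. (1 + \<bar>x\<bar>) ^ k * \<bar>F b (m' b) x\<bar> \<le> C b" by metis
    have "norm (norm x ^ k * tensor F m' x) \<le> (\<Prod>b\<in>Basis. C b)" for x :: 'a
    proof -
      have "norm x \<le> (\<Prod>b\<in>Basis. 1 + \<bar>x \<bullet> b\<bar>)"
        using norm_le_l1[of x] sum_le_prod_one_plus[of Basis "\<lambda>b. \<bar>x \<bullet> b\<bar>"] by simp
      then have "norm x ^ k \<le> (\<Prod>b\<in>Basis. (1 + \<bar>x \<bullet> b\<bar>) ^ k)"
        unfolding prod_power_distrib[symmetric] by (intro power_mono) auto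
      then have "norm (norm x ^ k * tensor F m' x) \<le> (\<Prod>b\<in>Basis. (1 + \<bar>x \<bullet> b\<bar>) ^ k) * \<bar>tensor F m' x\<bar>"
        by (simp add: abs_mult mult_right_mono)
      also have "\<dots> = (\<Prod>b\<in>Basis. (1 + \<bar>x \<bullet> b\<bar>) ^ k * \<bar>F b (m' b) (x \<bullet> b)\<bar>)"
        by (simp add: tensor_def abs_prod prod.distrib)
      also have "\<dots> \<le> (\<Prod>b\<in>Basis. C b)" using C by (intro prod_mono) auto
      finally show ?thesis .
    qed
    then show ?thesis unfolding bounded_iff by blast
  qed
  then show "(\<forall>x. pderivs bs (tensor F m) differentiable at x) \<and>
     (\<forall>k. bounded (range (\<lambda>x. norm x ^ k * pderivs bs (tensor F m) x)))"
    unfolding m' using tensor_has_derivative[where F=F, OF F] by (auto simp: differentiable_def)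
qed

section \<open>The bilaplacian of a tensor product\<close>

lemma laplacian_sum_tensor:
  assumes F: "\<And>b. schwartz_seq (F b)"
  shows "laplacian (\<lambda>x. \<Sum>a\<in>A. tensor F (m a) x) = (\<lambda>x. \<Sum>b\<in>Basis. \<Sum>a\<in>A. tensor F (incr b (incr b (m a))) x)"
  unfolding laplacian_def
proof (intro ext sum.cong refl)
  fix x b :: 'a assume b: "b \<in> Basis"
  have "pderivs [b] (\<lambda>x. \<Sum>a\<in>A. tensor F (m a) x) = (\<lambda>x. \<Sum>a\<in>A. tensor F (incr b (m a)) x)"
    unfolding pderivs.simps by (rule ext) (rule frechet_derivative_sum_tensor[where F=F, OF F b])
  then have "pderivs [b, b] (\<lambda>x. \<Sum>a\<in>A. tensor F (m a) x) = (\<lambda>x. frechet_derivative (\<lambda>x. \<Sum>a\<in>A. tensor F (incr b (m a)) x) (at x) b)"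
    by (simp only: pderivs.simps(2)[of b "[b]"])
  then show "pderivs [b, b] (\<lambda>x. \<Sum>a\<in>A. tensor F (m a) x) x = (\<Sum>a\<in>A. tensor F (incr b (incr b (m a))) x)"
    using frechet_derivative_sum_tensor[where F=F and A=A and m="\<lambda>a. incr b (m a)" and x=x, OF F b] by simp
qed

text \<open>The multi-index of two second derivatives, along \<open>fst p\<close> and along
  \<open>snd p\<close>; it takes the value 4 where the two directions coincide.\<close>

definition biidx :: "'a \<times> 'a \<Rightarrow> 'a \<Rightarrow> nat" where
  "biidx p e = (if e = fst p then 2 else 0) + (if e = snd p then 2 else 0)"

lemma bilaplacian_tensor:
  assumes F: "\<And>b. schwartz_seq (F b)"
  shows "bilaplacian (tensor F (\<lambda>_. 0)) x = (\<Sum>p\<in>Basis \<times> Basis. tensor F (biidx p) x)"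
proof -
  have "laplacian (tensor F (\<lambda>_. 0)) = (\<lambda>x. \<Sum>b\<in>Basis. tensor F (incr b (incr b (\<lambda>_. 0))) x)"
    using laplacian_sum_tensor[where F=F and A="{()}" and m="\<lambda>_ _. 0", OF F] by simp
  then have "bilaplacian (tensor F (\<lambda>_. 0)) x =
     (\<Sum>c\<in>Basis. \<Sum>b\<in>Basis. tensor F (incr c (incr c (incr b (incr b (\<lambda>_. 0))))) x)"
    unfolding bilaplacian_def by (simp only: laplacian_sum_tensor[where F=F, OF F])
  also have "\<dots> = (\<Sum>c\<in>Basis. \<Sum>b\<in>Basis. tensor F (biidx (c, b)) x)"
    by (intro sum.cong refl arg_cong[where f="\<lambda>m. tensor F m x"]) (auto simp: biidx_def fun_eq_iff)
  finally show ?thesis by (simp add: sum.cartesian_product)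
qed

section \<open>Integrals and Fourier transforms of tensor products\<close>

text \<open>Fubini: \<open>lborel\<close> is the image of the product of one-dimensional Lebesgue
  measures under the map from coordinates to vectors.\<close>

lemma
  fixes f :: "'a::euclidean_space \<Rightarrow> real \<Rightarrow> 'b::{real_normed_field,banach,second_countable_topology}"
  assumes f: "\<And>b. b \<in> Basis \<Longrightarrow> integrable lborel (f b)"
  shows integrable_lborel_prod_Basis: "integrable lborel (\<lambda>x::'a. \<Prod>b\<in>Basis. f b (x \<bullet> b))"
    and integral_lborel_prod_Basis:
      "(\<integral>x. (\<Prod>b\<in>Basis. f b (x \<bullet> b)) \<partial>(lborel :: 'a measure)) = (\<Prod>b\<in>Basis. \<integral>t. f b t \<partial>lborel)"
proof -
  interpret product_sigma_finite "\<lambda>_::'a. lborel :: real measure" ..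
  have lb: "(lborel :: 'a measure) = distr (\<Pi>\<^sub>M b\<in>Basis. lborel) borel (\<lambda>f. \<Sum>b\<in>Basis. f b *\<^sub>R b)"
    unfolding lborel_def[where 'a='a] lborel_eq_real ..
  have [measurable]: "f b \<in> borel_measurable borel" if "b \<in> Basis" for b
    using borel_measurable_integrable[OF f[OF that]] by simp
  have m: "(\<lambda>x::'a. \<Prod>b\<in>Basis. f b (x \<bullet> b)) \<in> borel_measurable borel"
    by measurable
  have m2: "(\<lambda>f. \<Sum>b\<in>(Basis::'a set). f b *\<^sub>R b) \<in> (\<Pi>\<^sub>M b\<in>Basis. lborel) \<rightarrow>\<^sub>M (borel :: 'a measure)"
    by measurable
  have eq: "(\<Prod>b\<in>Basis. f b ((\<Sum>c\<in>Basis. g c *\<^sub>R c) \<bullet> b)) = (\<Prod>b\<in>Basis. f b (g b))" for g :: "'a \<Rightarrow> real"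
    by (intro prod.cong refl) simp
  show "integrable lborel (\<lambda>x::'a. \<Prod>b\<in>Basis. f b (x \<bullet> b))"
    unfolding lb using integrable_distr_eq[OF m2 m] eq product_integrable_prod[OF finite_Basis f] by simp
  show "(\<integral>x. (\<Prod>b\<in>Basis. f b (x \<bullet> b)) \<partial>(lborel :: 'a measure)) = (\<Prod>b\<in>Basis. \<integral>t. f b t \<partial>lborel)"
    unfolding lb using integral_distr[OF m2 m] eq product_integral_prod[OF finite_Basis f] by simp
qed

lemma
  fixes F :: "'a::euclidean_space \<Rightarrow> nat \<Rightarrow> real \<Rightarrow> real"
  assumes F: "\<And>b. schwartz_seq (F b)"
  shows integrable_tensor_cube: "integrable lborel (\<lambda>x. tensor F m x * tensor F (\<lambda>_. 0) x ^ 3)"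
    and integral_tensor_cube: "(\<integral>x. tensor F m x * tensor F (\<lambda>_. 0) x ^ 3 \<partial>lborel) =
      (\<Prod>b\<in>Basis. \<integral>t. F b (m b) t * F b 0 t ^ 3 \<partial>lborel)"
proof -
  have eq: "tensor F m x * tensor F (\<lambda>_. 0) x ^ 3 = (\<Prod>b\<in>Basis. F b (m b) (x \<bullet> b) * F b 0 (x \<bullet> b) ^ 3)" for x
    by (simp add: tensor_def prod.distrib prod_power_distrib)
  note i = schwartz_seq_integrable_power[OF F]
  show "integrable lborel (\<lambda>x. tensor F m x * tensor F (\<lambda>_. 0) x ^ 3)"
    unfolding eq by (rule integrable_lborel_prod_Basis[OF i])
  show "(\<integral>x. tensor F m x * tensor F (\<lambda>_. 0) x ^ 3 \<partial>lborel) =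
      (\<Prod>b\<in>Basis. \<integral>t. F b (m b) t * F b 0 t ^ 3 \<partial>lborel)"
    unfolding eq by (rule integral_lborel_prod_Basis[OF i])
qed

text \<open>The inner product is a sum over coordinates, so the exponential factors. Integrability
  lets \<open>integral_lborel\<close> pass from the gauge integral of \<open>fourier\<close> to the
  Lebesgue integral.\<close>

lemma fourier_tensor:
  fixes F :: "'a::euclidean_space \<Rightarrow> nat \<Rightarrow> real \<Rightarrow> real"
  assumes F: "\<And>b. schwartz_seq (F b)"
  shows "fourier (tensor F (\<lambda>_. 0)) \<xi> =
    (\<Prod>b\<in>Basis. \<integral>t. of_real (F b 0 t) * cis (- ((\<xi> \<bullet> b) * t)) \<partial>lborel)"
proof -
  have cis_sum: "cis (\<Sum>b\<in>A. g b) = (\<Prod>b\<in>A. cis (g b))" if "finite A" for A and g :: "'a \<Rightarrow> real"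
    using that by (induction A rule: finite_induct) (simp_all flip: cis_mult)
  have "cis (- (\<xi> \<bullet> x)) = (\<Prod>b\<in>Basis. cis (- ((\<xi> \<bullet> b) * (x \<bullet> b))))" for x
    unfolding cis_sum[OF finite_Basis, symmetric] by (simp add: euclidean_inner[of \<xi> x] sum_negf)
  then have eq: "of_real (tensor F (\<lambda>_. 0) x) * cis (- (\<xi> \<bullet> x)) =
      (\<Prod>b\<in>Basis. of_real (F b 0 (x \<bullet> b)) * cis (- ((\<xi> \<bullet> b) * (x \<bullet> b))))" for x
    by (simp add: tensor_def prod.distrib)
  have i: "integrable lborel (\<lambda>t. of_real (F b 0 t) * cis (- ((\<xi> \<bullet> b) * t)))" for b
    by (rule schwartz_seq_integrable_mult[OF F, where B=1])
      (auto intro!: borel_measurable_continuous_onI continuous_intros)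
  show ?thesis
    unfolding fourier_def eq
    by (subst integral_lborel) (rule integrable_lborel_prod_Basis[OF i] integral_lborel_prod_Basis[OF i])+
qed

subsection \<open>Reduction to one dimension\<close>

text \<open>The sum is a polynomial in \<epsilon>. At 0, with \<open>0 ^ 0 = 1\<close>, every term
  differentiating in a direction other than \<open>b0\<close> vanishes and only
  \<open>\<rho> b0 4\<close> survives; continuity keeps the sign for small positive
  \<epsilon>.\<close>

lemma small_parameter_negative:
  fixes \<rho> :: "'a::euclidean_space \<Rightarrow> nat \<Rightarrow> real"
  assumes b0: "b0 \<in> Basis" and \<rho>0: "\<And>e. \<rho> e 0 = 1" and neg: "\<rho> b0 4 < 0"
  obtains \<epsilon> where "0 < \<epsilon>" "\<epsilon> \<le> 1"
    "(\<Sum>p\<in>Basis \<times> Basis. \<Prod>e\<in>Basis. (if e = b0 then 1 else \<epsilon>) ^ biidx p e * \<rho> e (biidx p e)) < 0"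
proof -
  define q where "q = (\<lambda>\<epsilon>. \<Sum>p\<in>Basis \<times> Basis. \<Prod>e\<in>Basis. (if e = b0 then 1 else \<epsilon>) ^ biidx p e * \<rho> e (biidx p e))"
  have "(\<Prod>e\<in>Basis. (if e = b0 then 1 else 0) ^ biidx p e * \<rho> e (biidx p e)) = (if p = (b0, b0) then \<rho> b0 4 else 0)"
    if "p \<in> Basis \<times> Basis" for p
  proof (cases "p = (b0, b0)")
    case True
    have "(\<Prod>e\<in>Basis. (if e = b0 then 1 else 0) ^ biidx p e * \<rho> e (biidx p e)) = (\<Prod>e\<in>Basis. if e = b0 then \<rho> b0 4 else 1)"
      using True by (intro prod.cong) (auto simp: biidx_def \<rho>0)
    then show ?thesis using True b0 by simp
  next
    case False
    \<comment> \<open>A direction other than \<open>b0\<close> occurring in \<open>p\<close>; its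
      factor carries a positive power of 0.\<close>
    define e where "e = (if fst p = b0 then snd p else fst p)"
    have "e \<in> Basis" "e \<noteq> b0" "biidx p e \<noteq> 0"
      using that False by (auto simp: e_def biidx_def prod_eq_iff)
    then have "\<exists>e\<in>Basis. (if e = b0 then 1 else 0) ^ biidx p e * \<rho> e (biidx p e) = 0"
      by (intro bexI[of _ e]) simp_all
    then show ?thesis using False by (subst prod_zero) auto
  qed
  then have "q 0 = (\<Sum>p\<in>Basis \<times> Basis. if p = (b0, b0) then \<rho> b0 4 else 0)"
    unfolding q_def by (intro sum.cong) auto
  also have "\<dots> = \<rho> b0 4" using b0 by simp
  finally have q0: "q 0 < 0" using neg by simp
  have c: "continuous_on UNIV (\<lambda>\<epsilon>::real. if e = b0 then 1 else \<epsilon>)" for e by (cases "e = b0") auto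
  have "continuous_on UNIV q" unfolding q_def by (intro continuous_intros c)
  then have "(q \<longlongrightarrow> q 0) (at_right 0)"
    by (metis continuous_on_eq_continuous_at isContD open_UNIV UNIV_I filterlim_at_split)
  then have "\<forall>\<^sub>F \<epsilon> in at_right 0. q \<epsilon> < 0" using q0 by (rule order_tendstoD)
  moreover have "\<forall>\<^sub>F \<epsilon>::real in at_right 0. 0 < \<epsilon> \<and> \<epsilon> < 1"
    using eventually_at_right_field[of "\<lambda>\<epsilon>. 0 < \<epsilon> \<and> \<epsilon> < 1" "0::real"] zero_less_one by blast
  ultimately have "\<forall>\<^sub>F \<epsilon> in at_right 0. q \<epsilon> < 0 \<and> 0 < \<epsilon> \<and> \<epsilon> < 1" by eventually_elim auto
  then obtain \<epsilon> where "q \<epsilon> < 0" "0 < \<epsilon>" "\<epsilon> < 1"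
    by (metis (mono_tags, lifting) eventually_happens trivial_limit_at_right_real)
  then show thesis using that[of \<epsilon>] unfolding q_def by simp
qed

text \<open>Numerator and denominator factor over the coordinates. The Jacobians of the dilations
  cancel in the quotient, and the derivatives, of total order four, produce exactly the
  \<open>N ^ 4\<close> of the normalisation, so the value is independent of
  \<open>N\<close>.\<close>

lemma bilaplacian_tensor_ratio:
  fixes F :: "'a::euclidean_space \<Rightarrow> nat \<Rightarrow> real \<Rightarrow> real" and s :: "'a \<Rightarrow> real"
  assumes F: "\<And>b. schwartz_seq (F b)" and nz: "\<And>b. F b 0 0 \<noteq> 0"
    and s: "\<And>b. s b > 0" and N: "N > 0"
  defines "\<rho> \<equiv> \<lambda>b m. (\<integral>t. F b m t * F b 0 t ^ 3 \<partial>lborel) / (\<integral>t. F b 0 t * F b 0 t ^ 3 \<partial>lborel)"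
    and "f \<equiv> tensor (\<lambda>b n t. (N * s b) ^ n * F b n (N * s b * t)) (\<lambda>_. 0)"
  shows "integral UNIV (\<lambda>x. bilaplacian f x * f x ^ 3) / (N ^ 4 * integral UNIV (\<lambda>x. f x ^ 4)) =
    (\<Sum>p\<in>Basis \<times> Basis. \<Prod>b\<in>Basis. s b ^ biidx p b * \<rho> b (biidx p b))"
proof -
  define S where "S = (\<lambda>b n t. (N * s b) ^ n * F b n (N * s b * t))"
  have Ns: "N * s b > 0" for b using N s by simp
  have S: "schwartz_seq (S b)" for b
    unfolding S_def using N s[of b] by (intro schwartz_seq_scale F) simp
  have f: "f = tensor S (\<lambda>_. 0)" by (simp add: f_def S_def)
  define I where "I = (\<lambda>b m. \<integral>t. S b m t * S b 0 t ^ 3 \<partial>lborel)"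
  have I: "I b m = (N * s b) ^ m * (1 / (N * s b)) * (\<integral>t. F b m t * F b 0 t ^ 3 \<partial>lborel)" for b m
    unfolding I_def S_def using integral_scale_quartic[OF Ns, of b m "F b"] by simp
  have pos: "(\<integral>t. F b 0 t * F b 0 t ^ 3 \<partial>lborel) > 0" for b
    by (rule schwartz_seq_fourth_moment_pos[OF F nz])
  have I_ratio: "I b m / I b 0 = (N * s b) ^ m * \<rho> b m" for b m
    using N s[of b] pos[of b] unfolding I \<rho>_def by simp
  have I0: "I b 0 \<noteq> 0" for b using N s[of b] pos[of b] unfolding I by simp
  have 4: "tensor S (\<lambda>_. 0) x ^ 4 = tensor S (\<lambda>_. 0) x * tensor S (\<lambda>_. 0) x ^ 3" for x by (simp add: power4_eq_xxxx power3_eq_cube)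
  have den: "integral UNIV (\<lambda>x. f x ^ 4) = (\<Prod>b\<in>Basis. I b 0)"
    unfolding f 4 I_def integral_lborel[OF integrable_tensor_cube[where F=S, OF S]]
    by (rule integral_tensor_cube[where F=S, OF S])
  have "integral UNIV (\<lambda>x. bilaplacian f x * f x ^ 3) =
      integral UNIV (\<lambda>x. \<Sum>p\<in>Basis \<times> Basis. tensor S (biidx p) x * tensor S (\<lambda>_. 0) x ^ 3)"
    unfolding f bilaplacian_tensor[where F=S, OF S] sum_distrib_right ..
  also have "\<dots> = (\<Sum>p\<in>Basis \<times> Basis. \<Prod>b\<in>Basis. I b (biidx p b))"
    unfolding I_def using integrable_tensor_cube[where F=S, OF S] integral_tensor_cube[where F=S, OF S]
    by (subst integral_lborel) simp_all
  finally have num: "integral UNIV (\<lambda>x. bilaplacian f x * f x ^ 3) = (\<Sum>p\<in>Basis \<times> Basis. \<Prod>b\<in>Basis. I b (biidx p b))" .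
  have summand: "(\<Prod>b\<in>Basis. I b (biidx p b)) / (N ^ 4 * (\<Prod>b\<in>Basis. I b 0)) =
      (\<Prod>b\<in>Basis. s b ^ biidx p b * \<rho> b (biidx p b))" if p: "p \<in> Basis \<times> Basis" for p
  proof -
    \<comment> \<open>Both directions of \<open>p\<close> lie in the basis, so each contributes its
      full 2 to the total order.\<close>
    have "(\<Sum>b\<in>Basis. biidx p b) = 4"
      using p by (auto simp: biidx_def sum.distrib)
    then have "(\<Prod>b\<in>Basis. N ^ biidx p b) = N ^ 4" by (metis power_sum)
    then have "(\<Prod>b\<in>Basis. I b (biidx p b) / I b 0) = N ^ 4 * (\<Prod>b\<in>Basis. s b ^ biidx p b * \<rho> b (biidx p b))"
      unfolding I_ratio power_mult_distrib mult.assoc by (simp add: prod.distrib)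
    then have "(\<Prod>b\<in>Basis. I b (biidx p b)) / (\<Prod>b\<in>Basis. I b 0) / N ^ 4 =
        (\<Prod>b\<in>Basis. s b ^ biidx p b * \<rho> b (biidx p b))"
      using N by (simp add: prod_dividef)
    then show ?thesis by (simp only: divide_divide_eq_left mult.commute)
  qed
  show ?thesis unfolding num den sum_divide_distrib using summand by (rule sum.cong[OF refl])
qed

section \<open>Assembly: the functions, their spectra and the constants\<close>

theorem theorem2p1:
  "\<exists>(C1::real) (C2::real) (\<alpha>1::real) (\<alpha>2::real) (N::nat \<Rightarrow> real) (f::nat \<Rightarrow> 'a::euclidean_space \<Rightarrow> real).
     C1 > 0 \<and> C2 > 0 \<and> \<alpha>1 > 0 \<and> \<alpha>2 > 0 \<and>
     filterlim N at_top sequentially \<and>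
     (\<forall>j. schwartz (f j) \<and>
          fsupport (fourier (f j)) \<subseteq> {\<xi>. \<alpha>1 * N j < norm \<xi> \<and> norm \<xi> < \<alpha>2 * N j} \<and>
          (let r = integral UNIV (\<lambda>x. bilaplacian (f j) x * f j x ^ 3) /
                   (N j ^ 4 * integral UNIV (\<lambda>x. f j x ^ 4))
           in - C2 < r \<and> r < - C1))"
proof -
  obtain K where K: "K > 2" and neg: "(\<integral>x. wave_pair K 4 x * wave_pair K 0 x ^ 3 \<partial>lborel) < 0"
    using wave_pair_negative by blast
  obtain b0 :: 'a where b0: "b0 \<in> Basis" using nonempty_Basis by blast
  define F :: "'a \<Rightarrow> nat \<Rightarrow> real \<Rightarrow> real" where "F = (\<lambda>b. if b = b0 then wave_pair K else wave 0)"
  have F: "schwartz_seq (F b)" for b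
    by (simp add: F_def schwartz_seq_wave_pair schwartz_seq_wave)
  have nz: "F b 0 0 \<noteq> 0" for b
    using wave_0_0_at_0 by (simp add: F_def wave_pair_0)
  define \<rho> where "\<rho> = (\<lambda>b m. (\<integral>t. F b m t * F b 0 t ^ 3 \<partial>lborel) / (\<integral>t. F b 0 t * F b 0 t ^ 3 \<partial>lborel))"
  have pos: "(\<integral>t. F b 0 t * F b 0 t ^ 3 \<partial>lborel) > 0" for b
    by (rule schwartz_seq_fourth_moment_pos[OF F nz])
  have \<rho>0: "\<rho> b 0 = 1" for b using pos[of b] by (simp add: \<rho>_def)
  have \<rho>4: "\<rho> b0 4 < 0" using pos[of b0] neg by (simp add: \<rho>_def F_def divide_neg_pos)
  obtain \<epsilon> where \<epsilon>: "0 < \<epsilon>" "\<epsilon> \<le> 1" and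
    q: "(\<Sum>p\<in>Basis \<times> Basis. \<Prod>e\<in>Basis. (if e = b0 then 1 else \<epsilon>) ^ biidx p e * \<rho> e (biidx p e)) < 0"
    using small_parameter_negative[of b0 \<rho>, OF b0 \<rho>0 \<rho>4] by blast
  define s where "s = (\<lambda>e. if e = b0 then 1 else \<epsilon>)"
  define r where "r = (\<Sum>p\<in>Basis \<times> Basis. \<Prod>e\<in>Basis. s e ^ biidx p e * \<rho> e (biidx p e))"
  have r: "r < 0" using q by (simp add: r_def s_def)
  have s: "s b > 0" for b using \<epsilon> by (simp add: s_def)
  \<comment> \<open>The shift by one keeps \<open>N j\<close> positive at
    \<open>j = 0\<close>.\<close>
  define N where "N = (\<lambda>j. real (Suc j))"
  have N: "N j > 0" for j by (simp add: N_def)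
  have Nlim: "filterlim N at_top sequentially"
    unfolding N_def by (rule filterlim_compose[OF filterlim_real_sequentially filterlim_Suc])
  define f where "f = (\<lambda>j. tensor (\<lambda>b n t. (N j * s b) ^ n * F b n (N j * s b * t)) (\<lambda>_. 0))"
  have S: "schwartz_seq (\<lambda>n t. (N j * s b) ^ n * F b n (N j * s b * t))" for j b
    using N[of j] s[of b] by (intro schwartz_seq_scale F) simp
  define D where "D = real DIM('a)"
  have D: "D \<ge> 1" using DIM_positive[where 'a='a] by (simp add: D_def Suc_le_eq)
  \<comment> \<open>The spectrum lies in a closed annulus, which also contains its closure. Halving
    the inner radius and adding \<open>N j\<close> to the outer one gives the strict
    inequalities.\<close>
  have supp: "fsupport (fourier (f j)) \<subseteq> {\<xi>. (K - 1) / 2 * N j < norm \<xi> \<and> norm \<xi> < (D * (3 * K + 1) + 1) * N j}" for j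
  proof -
    have "{\<xi>. fourier (f j) \<xi> \<noteq> 0} \<subseteq> {\<xi>. (K - 1) * N j \<le> norm \<xi> \<and> norm \<xi> \<le> D * (3 * K + 1) * N j}"
    proof safe
      fix \<xi> assume "fourier (f j) \<xi> \<noteq> 0"
      \<comment> \<open>A nonzero product has no zero factor, so every coordinate of \<xi> is
        confined to the spectrum of its own factor.\<close>
      then have "(\<integral>t. of_real (F b 0 (N j * s b * t)) * cis (- ((\<xi> \<bullet> b) * t)) \<partial>lborel) \<noteq> 0" if "b \<in> Basis" for b
        using fourier_tensor[where F="\<lambda>b n t. (N j * s b) ^ n * F b n (N j * s b * t)" and \<xi>=\<xi>, OF S] that
        by (auto simp: f_def)
      then have F_nz: "(\<integral>t. of_real (F b 0 t) * cis (- ((\<xi> \<bullet> b) / (N j * s b) * t)) \<partial>lborel) \<noteq> 0" if "b \<in> Basis" for b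
        using integral_scale_cis[of "N j * s b" "F b 0" "\<xi> \<bullet> b"] N s that by fastforce
      have "(\<integral>t. of_real (wave_pair K 0 t) * cis (- ((\<xi> \<bullet> b0) / N j * t)) \<partial>lborel) \<noteq> 0"
        using F_nz[OF b0] by (simp add: F_def s_def)
      then have "\<not> (\<bar>(\<xi> \<bullet> b0) / N j\<bar> < K - 1 \<or> \<bar>(\<xi> \<bullet> b0) / N j\<bar> > 3 * K + 1)"
        using wave_pair_fourier[of K "(\<xi> \<bullet> b0) / N j"] K by auto
      then have xb0: "(K - 1) * N j \<le> \<bar>\<xi> \<bullet> b0\<bar>" "\<bar>\<xi> \<bullet> b0\<bar> \<le> (3 * K + 1) * N j"
        using N[of j] by (simp_all add: field_simps not_less)
      have xb: "\<bar>\<xi> \<bullet> b\<bar> \<le> (3 * K + 1) * N j" if b: "b \<in> Basis" for b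
      proof (cases "b = b0")
        case False
        have "(\<integral>t. of_real (wave 0 0 t) * cis (- ((\<xi> \<bullet> b) / (N j * \<epsilon>) * t)) \<partial>lborel) \<noteq> 0"
          using F_nz[OF b] False by (simp add: F_def s_def)
        then have "\<bar>(\<xi> \<bullet> b) / (N j * \<epsilon>)\<bar> \<le> 1" using wave_0_0_fourier not_less by blast
        then have "\<bar>\<xi> \<bullet> b\<bar> \<le> N j * \<epsilon>" using N[of j] \<epsilon> by (simp add: field_simps abs_mult)
        also have "\<dots> \<le> N j * (3 * K + 1)" using N[of j] \<epsilon> K by (intro mult_left_mono) auto
        finally show ?thesis by (simp add: mult.commute)
      qed (use xb0 in simp)
      \<comment> \<open>The coordinate \<open>b0\<close> alone keeps the spectrum away from 0; the
        upper bound sums all coordinates, whence the dimension \<open>D\<close>.\<close>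
      show "(K - 1) * N j \<le> norm \<xi>" using xb0(1) Basis_le_norm[OF b0, of \<xi>] by linarith
      have "norm \<xi> \<le> (\<Sum>b\<in>Basis. \<bar>\<xi> \<bullet> b\<bar>)" by (rule norm_le_l1)
      also have "\<dots> \<le> (\<Sum>b\<in>(Basis::'a set). (3 * K + 1) * N j)" by (intro sum_mono xb)
      also have "\<dots> = D * (3 * K + 1) * N j" by (simp add: D_def)
      finally show "norm \<xi> \<le> D * (3 * K + 1) * N j" .
    qed
    moreover have "closed {\<xi>::'a. (K - 1) * N j \<le> norm \<xi> \<and> norm \<xi> \<le> D * (3 * K + 1) * N j}"
      by (intro closed_Collect_conj closed_Collect_le continuous_intros)
    ultimately have "fsupport (fourier (f j)) \<subseteq> {\<xi>. (K - 1) * N j \<le> norm \<xi> \<and> norm \<xi> \<le> D * (3 * K + 1) * N j}"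
      unfolding fsupport_def by (rule closure_minimal)
    moreover have "(K - 1) / 2 * N j < (K - 1) * N j" using K N[of j] by simp
    moreover have "D * (3 * K + 1) * N j < (D * (3 * K + 1) + 1) * N j" using N[of j] by (simp add: distrib_right)
    ultimately show ?thesis by (blast intro: less_le_trans le_less_trans)
  qed
  have ratio: "integral UNIV (\<lambda>x. bilaplacian (f j) x * f j x ^ 3) / (N j ^ 4 * integral UNIV (\<lambda>x. f j x ^ 4)) = r" for j
    unfolding f_def r_def \<rho>_def by (rule bilaplacian_tensor_ratio[where F=F, OF F nz s N])
  show ?thesis
  proof (intro exI conjI allI)
    \<comment> \<open>The ratio equals the same negative \<open>r\<close> for every
      \<open>j\<close>, so \<open>2 * r\<close> and \<open>r / 2\<close> enclose it
      strictly.\<close>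
    show "- r / 2 > 0" "- 2 * r > 0" using r by auto
    show "(K - 1) / 2 > 0" using K by simp
    show "D * (3 * K + 1) + 1 > 0" using K D by (simp add: add_pos_nonneg)
    show "filterlim N at_top sequentially" by (rule Nlim)
    fix j
    show "schwartz (f j)" unfolding f_def by (rule schwartz_tensor[OF S])
    show "fsupport (fourier (f j)) \<subseteq> {\<xi>. (K - 1) / 2 * N j < norm \<xi> \<and> norm \<xi> < (D * (3 * K + 1) + 1) * N j}"
      by (rule supp)
    show "let t = integral UNIV (\<lambda>x. bilaplacian (f j) x * f j x ^ 3) / (N j ^ 4 * integral UNIV (\<lambda>x. f j x ^ 4))
      in - (- 2 * r) < t \<and> t < - (- r / 2)"
      unfolding ratio Let_def using r by simp
  qed
qed

end
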